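(* Let $P$ be an $n\times n$ nonnegative matrix, let $I$ be an initial subset for $P$, and let $F_I=\{x\in\mathbb{R}^n_+:\operatorname{supp}(x)\subseteq I\}$. Let $\lambda$ be a real number. Then: (i) $F_I$ is a minimal nonzero $P$-invariant face of $\mathbb{R}^n_+$ if and only if $I$ is an initial class of $P$. (ii) $F_I$ is a nonzero $P$-invariant join-irreducible face if and only if $I$ is an initial subset determined by a single class. (iii) $F_I$ is a $P$-invariant face which contains in its relative interior a generalized eigenvector (respectively, an eigenvector) of $P$ corresponding to $\lambda$ if and only if $I$ is a nonempty initial subset such that each class final in the initial collection of classes corresponding to $I$ is a semi-distinguished (respectively, distinguished) class associated with $\lambda$. (iv) $F_I$ is a $P$-invariant join-irreducible face which contains in its relative interior a generalized eigenvector (respectively, an eigenvector) of $P$ corresponding to $\lambda$ if and only if $I$ is an initial subset determined by a semi-distinguished (respectively, distinguished) class associated with $\lambda$.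
   Context: Write $\langle n\rangle=\{1,\dots,n\}$. For $i,j\in\langle n\rangle$, $i$ has access to $j$ if $i=j$ or there is a directed path from $i$ to $j$ in the digraph of $P$ (which has an arc $(i,j)$ when $p_{ij}\ne0$). The classes of $P$ are the equivalence classes of the relation "$i$ has access to $j$ and $j$ has access to $i$" on $\langle n\rangle$. A class $\beta$ has access to a class $\alpha$ if some (equivalently every) element of $\beta$ has access to some (equivalently every) element of $\alpha$. For $S,T\subseteq\langle n\rangle$, $P_{ST}$ is the submatrix with rows indexed by $S$ and columns by $T$; $\rho$ denotes spectral radius. A class $\alpha$ is associated with $\lambda$ if $\rho(P_{\alpha\alpha})=\lambda$. A class $\alpha$ is semi-distinguished (respectively, distinguished) if $\rho(P_{\beta\beta})\le\rho(P_{\alpha\alpha})$ (respectively, $\rho(P_{\beta\beta})<\rho(P_{\alpha\alpha})$) for every class $\beta\neq\alpha$ having access to $\alpha$. A class is initial if no other class has access to it. A subset $I\subseteq\langle n\rangle$ is an initial subset for $P$ if $I=\emptyset$ or $P_{I'I}=0$ with $I'=\langle n\rangle\setminus I$; equivalently, $I$ contains every $j$ that has access to an element of $I$. A nonempty initial subset is the union of a unique collection of classes of $P$, the initial collection corresponding to $I$ (it contains with each class $\alpha$ all classes having access to $\alpha$). A class in a collection is final in the collection if it has no access to other classes of the collection. $I$ is determined by a class $\alpha$ if $I$ is the union of all classes having access to $\alpha$ (including $\alpha$ itself). A face of $\mathbb{R}^n_+$ is a convex subcone $F$ such that $x,y\in\mathbb{R}^n_+$, $x+y\in F$ imply $x,y\in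 F$. $F$ is $P$-invariant if $PF\subseteq F$; the $P$-invariant faces form a lattice under inclusion, with join $F\vee G$ the smallest face containing $F\cup G$. A $P$-invariant face $F$ is $P$-invariant join-irreducible if it is not the join of two $P$-invariant faces properly included in $F$. A generalized eigenvector of $P$ corresponding to $\lambda$ is a nonzero vector $x$ with $(\lambda I-P)^kx=0$ for some positive integer $k$. *)

theory Defs
  imports "HOL-Analysis.Analysis"
begin

section \<open>Digraph and classes of a matrix\<close>

definition arcs :: "real^'n^'n \<Rightarrow> ('n \<times> 'n) set" where
  "arcs P = {(i, j). P $ i $ j \<noteq> 0}"

definition has_access :: "real^'n^'n \<Rightarrow> 'n \<Rightarrow> 'n \<Rightarrow> bool" where
  "has_access P i j \<longleftrightarrow> (i, j) \<in> (arcs P)\<^sup>*"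

definition classes :: "real^'n^'n \<Rightarrow> 'n set set" where
  "classes P = UNIV // {(i, j). has_access P i j \<and> has_access P j i}"

definition class_access :: "real^'n^'n \<Rightarrow> 'n set \<Rightarrow> 'n set \<Rightarrow> bool" where
  "class_access P \<beta> \<alpha> \<longleftrightarrow> (\<exists>i\<in>\<beta>. \<exists>j\<in>\<alpha>. has_access P i j)"

definition initial_class :: "real^'n^'n \<Rightarrow> 'n set \<Rightarrow> bool" where
  "initial_class P \<alpha> \<longleftrightarrow>
     \<alpha> \<in> classes P \<and> (\<forall>\<beta>\<in>classes P. \<beta> \<noteq> \<alpha> \<longrightarrow> \<not> class_access P \<beta> \<alpha>)"

section \<open>Spectral radius of principal submatrices\<close>

text \<open>Complex eigenvalues of the principal submatrix with rows and columns indexed by \<open>S\<close>.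
  An eigenvector in \<open>\<complex>\<^sup>S\<close> is represented by a function of which only the values on \<open>S\<close> matter.
  For nonempty \<open>S\<close> this set is finite and nonempty, so the supremum below is a maximum.\<close>

definition sub_spectrum :: "real^'n^'n \<Rightarrow> 'n set \<Rightarrow> complex set" where
  "sub_spectrum P S =
     {z. \<exists>x :: 'n \<Rightarrow> complex. (\<exists>i\<in>S. x i \<noteq> 0) \<and>
           (\<forall>i\<in>S. (\<Sum>j\<in>S. complex_of_real (P $ i $ j) * x j) = z * x i)}"

definition sub_spectral_radius :: "real^'n^'n \<Rightarrow> 'n set \<Rightarrow> real" where
  "sub_spectral_radius P S = (SUP z\<in>sub_spectrum P S. cmod z)"

definition associated_with :: "real^'n^'n \<Rightarrow> 'n set \<Rightarrow> real \<Rightarrow> bool" where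
  "associated_with P \<alpha> lam \<longleftrightarrow> sub_spectral_radius P \<alpha> = lam"

definition semi_distinguished_class :: "real^'n^'n \<Rightarrow> 'n set \<Rightarrow> bool" where
  "semi_distinguished_class P \<alpha> \<longleftrightarrow> \<alpha> \<in> classes P \<and>
     (\<forall>\<beta>\<in>classes P. \<beta> \<noteq> \<alpha> \<longrightarrow> class_access P \<beta> \<alpha> \<longrightarrow>
        sub_spectral_radius P \<beta> \<le> sub_spectral_radius P \<alpha>)"

definition distinguished_class :: "real^'n^'n \<Rightarrow> 'n set \<Rightarrow> bool" where
  "distinguished_class P \<alpha> \<longleftrightarrow> \<alpha> \<in> classes P \<and>
     (\<forall>\<beta>\<in>classes P. \<beta> \<noteq> \<alpha> \<longrightarrow> class_access P \<beta> \<alpha> \<longrightarrow>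
        sub_spectral_radius P \<beta> < sub_spectral_radius P \<alpha>)"

section \<open>Initial subsets\<close>

definition initial_subset :: "real^'n^'n \<Rightarrow> 'n set \<Rightarrow> bool" where
  "initial_subset P I \<longleftrightarrow> I = {} \<or> (\<forall>i\<in>- I. \<forall>j\<in>I. P $ i $ j = 0)"

text \<open>An initial subset is a union of classes; since the classes partition the index set,
  the collection described here exists and is unique.\<close>

definition initial_collection :: "real^'n^'n \<Rightarrow> 'n set \<Rightarrow> 'n set set" where
  "initial_collection P I = (THE C. C \<subseteq> classes P \<and> \<Union>C = I)"

definition final_in :: "real^'n^'n \<Rightarrow> 'n set set \<Rightarrow> 'n set \<Rightarrow> bool" where
  "final_in P C \<alpha> \<longleftrightarrow> \<alpha> \<in> C \<and> (\<forall>\<beta>\<in>C. \<beta> \<noteq> \<alpha> \<longrightarrow> \<not> class_access P \<alpha> \<beta>)"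

text \<open>Every class has access to itself, so the union below includes \<open>\<alpha>\<close>.\<close>

definition determined_by :: "real^'n^'n \<Rightarrow> 'n set \<Rightarrow> 'n set \<Rightarrow> bool" where
  "determined_by P I \<alpha> \<longleftrightarrow> \<alpha> \<in> classes P \<and> I = \<Union>{\<beta> \<in> classes P. class_access P \<beta> \<alpha>}"

section \<open>Faces of the nonnegative orthant\<close>

definition nonneg_orthant :: "(real^'n) set" where
  "nonneg_orthant = {x. \<forall>i. 0 \<le> x $ i}"

text \<open>Unlike \<^const>\<open>face_of\<close>, which also admits the empty set, faces here are convex cones,
  hence contain 0.\<close>

definition orthant_face :: "(real^'n) set \<Rightarrow> bool" where
  "orthant_face F \<longleftrightarrow> convex_cone F \<and> F \<subseteq> nonneg_orthant \<and>
     (\<forall>x\<in>nonneg_orthant. \<forall>y\<in>nonneg_orthant. x + y \<in> F \<longrightarrow> x \<in> F \<and> y \<in> F)"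

definition invariant_face :: "real^'n^'n \<Rightarrow> (real^'n) set \<Rightarrow> bool" where
  "invariant_face P F \<longleftrightarrow> orthant_face F \<and> (\<lambda>x. P *v x) ` F \<subseteq> F"

text \<open>The smallest face containing both arguments.\<close>

definition face_join :: "(real^'n) set \<Rightarrow> (real^'n) set \<Rightarrow> (real^'n) set" where
  "face_join F G = \<Inter>{H. orthant_face H \<and> F \<union> G \<subseteq> H}"

definition minimal_nonzero_invariant_face :: "real^'n^'n \<Rightarrow> (real^'n) set \<Rightarrow> bool" where
  "minimal_nonzero_invariant_face P F \<longleftrightarrow> invariant_face P F \<and> F \<noteq> {0} \<and>
     (\<forall>G. invariant_face P G \<and> G \<noteq> {0} \<and> G \<subseteq> F \<longrightarrow> G = F)"

definition join_irreducible_face :: "real^'n^'n \<Rightarrow> (real^'n) set \<Rightarrow> bool" where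
  "join_irreducible_face P F \<longleftrightarrow> invariant_face P F \<and>
     \<not> (\<exists>G H. invariant_face P G \<and> invariant_face P H \<and> G \<subset> F \<and> H \<subset> F \<and> F = face_join G H)"

definition support_face :: "'n set \<Rightarrow> (real^'n) set" where
  "support_face I = {x \<in> nonneg_orthant. {i. x $ i \<noteq> 0} \<subseteq> I}"

section \<open>Eigenvectors\<close>

definition eigenvector :: "real^'n^'n \<Rightarrow> real \<Rightarrow> real^'n \<Rightarrow> bool" where
  "eigenvector P lam x \<longleftrightarrow> x \<noteq> 0 \<and> P *v x = lam *\<^sub>R x"

text \<open>The power is the iterate of the linear map, since \<open>^\<close> on \<^typ>\<open>real^'n^'n\<close> is taken
  componentwise.\<close>

definition generalized_eigenvector :: "real^'n^'n \<Rightarrow> real \<Rightarrow> real^'n \<Rightarrow> bool" where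
  "generalized_eigenvector P lam x \<longleftrightarrow>
     x \<noteq> 0 \<and> (\<exists>k>0. ((\<lambda>y. (lam *\<^sub>R mat 1 - P) *v y) ^^ k) x = 0)"

end

theory Submission
  imports Defs "HOL-Computational_Algebra.Fundamental_Theorem_Algebra"
begin

text \<open>
  The faces of the orthant are the sets \<open>support_face J\<close>; such a face is invariant iff \<open>J\<close> is closed
  under access, and joins correspond to unions. This settles (i) and (ii), and reduces (iv) to (iii).

  For (iii), each class \<open>\<beta>\<close> carries positive right and left Perron vectors, obtained from Brouwer's
  theorem. Suppose \<open>x\<close> is positive exactly on \<open>I\<close> and \<open>(\<lambda> - P)^k x = 0\<close>. Pairing with the left Perron
  vector of a final class \<open>\<alpha>\<close> multiplies the pairing by \<open>(\<lambda> - \<rho>\<^sub>\<alpha>)^k\<close>, so \<open>\<rho>\<^sub>\<alpha> = \<lambda>\<close>; pairing \<open>P^m x\<close>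
  with the left Perron vector of any \<open>\<beta> \<subseteq> I\<close> grows at least like \<open>\<rho>\<^sub>\<beta>^m\<close>, so \<open>\<rho>\<^sub>\<beta> \<le> \<lambda>\<close>.

  Conversely, let \<open>u\<close> be the sum of the Perron vectors of the final classes, so that \<open>P u \<ge> \<lambda> u\<close>, and
  split \<open>u = x + w\<close> with \<open>(\<lambda> - P)^k x = 0\<close> and \<open>w\<close> in an invariant subspace where \<open>\<lambda>\<close> is not an
  eigenvalue. All eigenvalues there have modulus at most \<open>\<lambda>\<close>, so after adding the identity they have
  modulus less than \<open>\<lambda> + 1\<close>: the iterates \<open>(P + 1)^m w\<close> are negligible against
  \<open>(P + 1)^m u \<ge> (\<lambda> + 1)^m u\<close>, and \<open>(P + 1)^m x\<close> is positive on \<open>I\<close> for large \<open>m\<close>. In the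
  semi-distinguished case the splitting is Fitting's; in the distinguished case \<open>\<lambda> - P\<close> is invertible on
  the non-final part of \<open>I\<close>, which contains the support of \<open>(\<lambda> - P) u\<close>, and \<open>k = 1\<close>.
\<close>

section \<open>Classes and access-closed sets\<close>

lemma has_access_refl [simp]: "has_access P i i"
  by (simp add: has_access_def)

lemma has_access_trans: "has_access P i j \<Longrightarrow> has_access P j k \<Longrightarrow> has_access P i k"
  unfolding has_access_def by (rule rtrancl_trans)

lemma has_access_transpose: "has_access (transpose P) i j \<longleftrightarrow> has_access P j i"
proof -
  have "arcs (transpose P) = (arcs P)\<inverse>"
    by (auto simp: arcs_def transpose_def)
  then show ?thesis
    by (simp add: has_access_def rtrancl_converse)
qed

lemma classes_transpose: "classes (transpose P) = classes P"
  unfolding classes_def has_access_transpose by (simp add: conj_commute)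

definition class_of :: "real^'n^'n \<Rightarrow> 'n \<Rightarrow> 'n set" where
  "class_of P i = {j. has_access P i j \<and> has_access P j i}"

lemma classes_eq: "classes P = range (class_of P)"
  by (auto simp: classes_def class_of_def quotient_def)

lemma class_of_in_classes [simp]: "class_of P i \<in> classes P"
  by (simp add: classes_eq)

lemma mem_class_of_self [simp]: "i \<in> class_of P i"
  by (simp add: class_of_def)

lemma class_of_eqI: "\<beta> \<in> classes P \<Longrightarrow> i \<in> \<beta> \<Longrightarrow> \<beta> = class_of P i"
  by (auto simp: classes_eq class_of_def intro: has_access_trans)

lemma class_nonempty: "\<beta> \<in> classes P \<Longrightarrow> \<exists>i. i \<in> \<beta>"
  by (auto simp: classes_eq intro: mem_class_of_self)

lemma class_has_access: "\<beta> \<in> classes P \<Longrightarrow> i \<in> \<beta> \<Longrightarrow> j \<in> \<beta> \<Longrightarrow> has_access P i j"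
  by (auto simp: classes_eq class_of_def intro: has_access_trans)

lemma class_memI:
  "\<beta> \<in> classes P \<Longrightarrow> i \<in> \<beta> \<Longrightarrow> has_access P i j \<Longrightarrow> has_access P j i \<Longrightarrow> j \<in> \<beta>"
  using class_of_eqI[of \<beta> P i] by (simp add: class_of_def)

lemma class_access_iff:
  assumes "\<beta> \<in> classes P" "\<alpha> \<in> classes P" "i \<in> \<beta>" "j \<in> \<alpha>"
  shows "class_access P \<beta> \<alpha> \<longleftrightarrow> has_access P i j"
  using assms unfolding class_access_def
  by (meson class_has_access has_access_trans)

definition access_closed :: "real^'n^'n \<Rightarrow> 'n set \<Rightarrow> bool" where
  "access_closed P I \<longleftrightarrow> (\<forall>i j. has_access P i j \<longrightarrow> j \<in> I \<longrightarrow> i \<in> I)"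

text \<open>Closure under single arcs is carried backwards along a path one arc at a time;
  conversely an arc into \<open>I\<close> is a path of length one. The empty set satisfies both
  conditions vacuously.\<close>

lemma initial_subset_iff: "initial_subset P I \<longleftrightarrow> access_closed P I"
proof
  assume I: "initial_subset P I"
  have "i \<in> I" if "(i, j) \<in> (arcs P)\<^sup>*" "j \<in> I" for i j
    using that
  proof (induction rule: converse_rtrancl_induct)
    case (step y z)
    then show ?case
      using I by (auto simp: initial_subset_def arcs_def)
  qed
  then show "access_closed P I"
    by (auto simp: access_closed_def has_access_def)
next
  assume I: "access_closed P I"
  have "P $ i $ j = 0" if "i \<notin> I" "j \<in> I" for i j
  proof (rule ccontr)
    assume "P $ i $ j \<noteq> 0"
    then have "has_access P i j"
      by (auto simp: has_access_def arcs_def)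
    then show False
      using I that by (auto simp: access_closed_def)
  qed
  then show "initial_subset P I"
    by (auto simp: initial_subset_def)
qed

lemma access_closedD: "access_closed P I \<Longrightarrow> has_access P i j \<Longrightarrow> j \<in> I \<Longrightarrow> i \<in> I"
  by (auto simp: access_closed_def)

lemma has_access_arc: "P $ i $ j \<noteq> 0 \<Longrightarrow> has_access P i j"
  by (auto simp: has_access_def arcs_def)

lemma class_subset_closed:
  "access_closed P I \<Longrightarrow> \<beta> \<in> classes P \<Longrightarrow> i \<in> \<beta> \<Longrightarrow> i \<in> I \<Longrightarrow> \<beta> \<subseteq> I"
  by (meson access_closedD class_has_access subsetI)

section \<open>Initial collections and final classes\<close>

text \<open>Resolves the definite description. A class is recovered from any one of its elements, so
  a collection of classes covering \<open>I\<close> must contain every class inside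
  \<open>I\<close>.\<close>

lemma initial_collection_eq:
  assumes "access_closed P I"
  shows "initial_collection P I = {\<beta> \<in> classes P. \<beta> \<subseteq> I}"
  unfolding initial_collection_def
proof (rule the_equality)
  have "i \<in> \<Union>{\<beta> \<in> classes P. \<beta> \<subseteq> I}" if "i \<in> I" for i
    using class_subset_closed[OF assms class_of_in_classes mem_class_of_self that]
    by (intro UnionI[of "class_of P i"]) auto
  then show "{\<beta> \<in> classes P. \<beta> \<subseteq> I} \<subseteq> classes P \<and> \<Union>{\<beta> \<in> classes P. \<beta> \<subseteq> I} = I"
    by blast
next
  fix C assume C: "C \<subseteq> classes P \<and> \<Union>C = I"
  have "\<beta> \<in> C" if \<beta>: "\<beta> \<in> classes P" "\<beta> \<subseteq> I" for \<beta>
  proof -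
    obtain i where i: "i \<in> \<beta>"
      using class_nonempty[OF \<beta>(1)] by blast
    moreover obtain \<gamma> where "\<gamma> \<in> C" "i \<in> \<gamma>"
      using C \<beta> i by blast
    ultimately show ?thesis
      using C \<beta> class_of_eqI by (metis subsetD)
  qed
  with C show "C = {\<beta> \<in> classes P. \<beta> \<subseteq> I}"
    by blast
qed

text \<open>Among the elements of \<open>X\<close> reachable from \<open>i\<close>, take one that
  reaches the fewest elements of \<open>X\<close>; an element reachable from it without a way back
  would reach strictly fewer. The set \<open>X\<close> is arbitrary because it will be an initial
  subset in one use and the support of an eigenvector in another.\<close>

lemma exists_final_index:
  fixes P :: "real^'n^'n"
  assumes "i \<in> X"
  obtains j where "j \<in> X" "has_access P i j"
    "\<And>k. k \<in> X \<Longrightarrow> has_access P j k \<Longrightarrow> has_access P k j"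
proof -
  let ?Y = "{j \<in> X. has_access P i j}"
  let ?f = "\<lambda>j. card {k \<in> X. has_access P j k}"
  have "?Y \<noteq> {}" using assms by auto
  then obtain j where j: "j \<in> ?Y" and min: "\<And>k. k \<in> ?Y \<Longrightarrow> ?f j \<le> ?f k"
    using ex_min_if_finite[of "?f ` ?Y"] by (auto simp: not_less image_iff)
  have "has_access P k j" if k: "k \<in> X" "has_access P j k" for k
  proof (rule ccontr)
    assume "\<not> has_access P k j"
    then have "{l \<in> X. has_access P k l} \<subset> {l \<in> X. has_access P j l}"
      using k j by (auto intro: has_access_trans)
    then have "?f k < ?f j"
      by (intro psubset_card_mono) auto
    moreover have "k \<in> ?Y"
      using k j by (auto intro: has_access_trans)
    ultimately show False
      using min by fastforce
  qed
  then show ?thesis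
    using that j by blast
qed

text \<open>Turns a condition on pairs of classes into one on indices: paths out of \<alpha> that
  end in \<open>I\<close> end in \<alpha>. It holds because the class of any index of
  \<open>I\<close> lies inside \<open>I\<close>, hence belongs to the collection.\<close>

lemma final_in_closed_iff:
  assumes "access_closed P I"
  shows "final_in P (initial_collection P I) \<alpha> \<longleftrightarrow>
    \<alpha> \<in> classes P \<and> \<alpha> \<subseteq> I \<and> (\<forall>i\<in>\<alpha>. \<forall>j\<in>I. has_access P i j \<longrightarrow> j \<in> \<alpha>)"
    (is "?L \<longleftrightarrow> ?R")
proof
  assume L: ?L
  then have \<alpha>: "\<alpha> \<in> classes P" "\<alpha> \<subseteq> I"
    by (auto simp: final_in_def initial_collection_eq[OF assms])
  have "j \<in> \<alpha>" if "i \<in> \<alpha>" "j \<in> I" "has_access P i j" for i j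
  proof -
    have "class_of P j \<subseteq> I"
      using assms class_subset_closed that(2) by (metis class_of_in_classes mem_class_of_self)
    moreover have "class_access P \<alpha> (class_of P j)"
      using that unfolding class_access_def by (metis mem_class_of_self)
    ultimately have "class_of P j = \<alpha>"
      using L class_of_in_classes[of P j]
      unfolding final_in_def initial_collection_eq[OF assms] by blast
    then show ?thesis by (metis mem_class_of_self)
  qed
  with \<alpha> show ?R by blast
next
  assume R: ?R
  have "\<not> class_access P \<alpha> \<beta>" if "\<beta> \<in> classes P" "\<beta> \<subseteq> I" "\<beta> \<noteq> \<alpha>" for \<beta>
  proof
    assume "class_access P \<alpha> \<beta>"
    then obtain i j where "i \<in> \<alpha>" "j \<in> \<beta>" "has_access P i j"
      by (auto simp: class_access_def)
    then have "j \<in> \<alpha>" using R that by blast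
    then show False
      using that R \<open>j \<in> \<beta>\<close> class_of_eqI by metis
  qed
  then show ?L
    using R by (auto simp: final_in_def initial_collection_eq[OF assms])
qed

text \<open>The class of an index of \<open>I\<close> that is terminal within \<open>I\<close> is
  final.\<close>

lemma exists_final_class:
  assumes "access_closed P I" "i \<in> I"
  obtains \<alpha> j where "final_in P (initial_collection P I) \<alpha>" "j \<in> \<alpha>" "has_access P i j"
proof -
  obtain j where j: "j \<in> I" "has_access P i j"
    "\<And>k. k \<in> I \<Longrightarrow> has_access P j k \<Longrightarrow> has_access P k j"
    using exists_final_index[OF assms(2), of P] by blast
  have "class_of P j \<subseteq> I"
    using assms(1) class_subset_closed j(1) by (metis class_of_in_classes mem_class_of_self)
  moreover have "\<forall>i\<in>class_of P j. \<forall>k\<in>I. has_access P i k \<longrightarrow> k \<in> class_of P j"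
    using j unfolding class_of_def by (blast intro: has_access_trans)
  ultimately have "final_in P (initial_collection P I) (class_of P j)"
    by (simp add: final_in_closed_iff[OF assms(1)])
  then show ?thesis
    using that[OF _ mem_class_of_self j(2)] by blast
qed

text \<open>Trades the union of classes for the set of all indices with access to one representative
  \<open>a\<close>, which is easier to compare with closed sets.\<close>

lemma determined_by_iff:
  assumes "\<alpha> \<in> classes P" "a \<in> \<alpha>"
  shows "determined_by P I \<alpha> \<longleftrightarrow> I = {i. has_access P i a}"
proof -
  have "(\<Union>{\<beta> \<in> classes P. class_access P \<beta> \<alpha>}) = {i. has_access P i a}" (is "?A = ?B")
  proof
    show "?A \<subseteq> ?B"
      using assms by (auto simp: class_access_iff)
    have "i \<in> ?A" if "i \<in> ?B" for i
      using that assms by (intro UnionI[of "class_of P i"]) (auto simp: class_access_iff[where i=i])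
    then show "?B \<subseteq> ?A" by blast
  qed
  then show ?thesis
    using assms by (simp add: determined_by_def)
qed

lemma access_closed_access_set: "access_closed P {i. has_access P i a}"
  by (auto simp: access_closed_def intro: has_access_trans)

text \<open>Everything in \<open>I\<close> has access to the representative \<open>a\<close>, so a
  final class must contain \<open>a\<close>. With a single final class, (iv) becomes an instance of
  (iii).\<close>

lemma final_in_determined:
  assumes "\<alpha> \<in> classes P" "determined_by P I \<alpha>"
  shows "final_in P (initial_collection P I) \<beta> \<longleftrightarrow> \<beta> = \<alpha>"
proof -
  obtain a where a: "a \<in> \<alpha>" using class_nonempty[OF assms(1)] by blast
  have I: "I = {i. has_access P i a}"
    using determined_by_iff[OF assms(1) a] assms(2) by simp
  have cl: "access_closed P I"
    unfolding I by (rule access_closed_access_set)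
  show ?thesis
    unfolding final_in_closed_iff[OF cl]
  proof
    assume R: "\<beta> \<in> classes P \<and> \<beta> \<subseteq> I \<and> (\<forall>i\<in>\<beta>. \<forall>j\<in>I. has_access P i j \<longrightarrow> j \<in> \<beta>)"
    then obtain b where "b \<in> \<beta>" using class_nonempty by blast
    then have "a \<in> \<beta>" using R unfolding I by auto
    then show "\<beta> = \<alpha>"
      using R assms(1) a class_of_eqI by metis
  next
    assume "\<beta> = \<alpha>"
    then show "\<beta> \<in> classes P \<and> \<beta> \<subseteq> I \<and> (\<forall>i\<in>\<beta>. \<forall>j\<in>I. has_access P i j \<longrightarrow> j \<in> \<beta>)"
      using assms(1) a class_has_access has_access_trans class_memI unfolding I
      by (smt (verit) mem_Collect_eq subsetI)
  qed
qed

section \<open>Invariant faces\<close>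

lemma nonneg_orthant_iff: "x \<in> nonneg_orthant \<longleftrightarrow> (\<forall>i. 0 \<le> x $ i)"
  by (simp add: nonneg_orthant_def)

lemma support_face_iff: "x \<in> support_face J \<longleftrightarrow> (\<forall>i. 0 \<le> x $ i) \<and> (\<forall>i. i \<notin> J \<longrightarrow> x $ i = 0)"
  by (auto simp: support_face_def nonneg_orthant_def)

lemma indicator_mem_support_face: "(\<chi> i. if i \<in> J then 1 else 0) \<in> support_face J"
  by (simp add: support_face_iff)

lemma support_face_mono_iff: "support_face J \<subseteq> support_face K \<longleftrightarrow> J \<subseteq> K"
proof
  assume "support_face J \<subseteq> support_face K"
  then have "(\<chi> i. if i \<in> J then 1 else 0) \<in> support_face K"
    using indicator_mem_support_face by blast
  then show "J \<subseteq> K"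
    by (auto simp: support_face_iff split: if_splits)
qed (auto simp: support_face_iff subset_eq)

lemma support_face_eq_iff: "support_face J = support_face K \<longleftrightarrow> J = K"
  by (metis support_face_mono_iff subset_antisym order_refl)

lemma support_face_empty: "support_face {} = {0}"
  by (auto simp: support_face_iff vec_eq_iff)

lemma support_face_eq_zero_iff: "support_face J = {0} \<longleftrightarrow> J = {}"
  by (metis support_face_empty support_face_eq_iff)

lemma convex_cone_support_face: "convex_cone (support_face J)"
  by (simp add: convex_cone_iff support_face_iff)

lemma orthant_face_support_face: "orthant_face (support_face J)"
  unfolding orthant_face_def
proof (intro conjI ballI impI)
  fix x y :: "real^'a"
  assume "x \<in> nonneg_orthant" "y \<in> nonneg_orthant" "x + y \<in> support_face J"
  then show "x \<in> support_face J" "y \<in> support_face J"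
    by (auto simp: support_face_iff nonneg_orthant_iff add_nonneg_eq_0_iff)
qed (use convex_cone_support_face in \<open>auto simp: support_face_iff nonneg_orthant_iff\<close>)

text \<open>The set \<open>J\<close> collects the coordinates in which some member of
  \<open>F\<close> is nonzero. The face property isolates each such coordinate axis, and the cone
  operations then generate all nonnegative vectors supported on \<open>J\<close>.\<close>

lemma orthant_face_cases:
  fixes F :: "(real^'n) set"
  assumes "orthant_face F"
  obtains J where "F = support_face J"
proof
  define J where "J = {i. \<exists>x\<in>F. x $ i \<noteq> 0}"
  have cone: "convex_cone F" and nonneg: "F \<subseteq> nonneg_orthant"
    and face: "\<And>x y. x \<in> nonneg_orthant \<Longrightarrow> y \<in> nonneg_orthant \<Longrightarrow> x + y \<in> F \<Longrightarrow> x \<in> F"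
    using assms by (auto simp: orthant_face_def)
  have axis: "c *\<^sub>R axis i 1 \<in> F" if "i \<in> J" "0 \<le> c" for i c
  proof -
    obtain x where x: "x \<in> F" "x $ i \<noteq> 0" using \<open>i \<in> J\<close> by (auto simp: J_def)
    have nn: "\<And>j. 0 \<le> x $ j"
      using x(1) nonneg by (auto simp: nonneg_orthant_iff)
    \<comment> \<open>\<open>x\<close> is the sum of its \<open>i\<close>-th coordinate part and a
      nonnegative remainder, so the face property applies.\<close>
    have "axis i (x $ i) \<in> F"
      by (rule face[of _ "x - axis i (x $ i)"]) (use nn x in \<open>auto simp: nonneg_orthant_iff axis_def\<close>)
    then have "(c / x $ i) *\<^sub>R axis i (x $ i) \<in> F"
      using nn[of i] that by (intro convex_cone_scaleR[OF cone]) auto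
    also have "(c / x $ i) *\<^sub>R axis i (x $ i) = c *\<^sub>R axis i 1"
      using x by (auto simp: vec_eq_iff axis_def)
    finally show ?thesis .
  qed
  show "F = support_face J"
  proof
    show "F \<subseteq> support_face J"
      using nonneg by (auto simp: support_face_iff nonneg_orthant_iff J_def)
    show "support_face J \<subseteq> F"
    proof
      fix x assume x: "x \<in> support_face J"
      have "(\<Sum>i\<in>S. (x $ i) *\<^sub>R axis i 1) \<in> F" if "finite S" for S
        using that
      proof (induction S rule: finite_induct)
        case empty
        then show ?case using cone by (simp add: convex_cone_iff)
      next
        case (insert i S)
        have "(x $ i) *\<^sub>R axis i 1 \<in> F"
        proof (cases "i \<in> J")
          case True
          then show ?thesis using x axis by (auto simp: support_face_iff)
        next
          case False
          then show ?thesis using x cone by (simp add: support_face_iff convex_cone_iff)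
        qed
        then show ?case
          using insert convex_cone_add[OF cone] by simp
      qed
      from this[of UNIV] show "x \<in> F"
        using basis_expansion[of x] by (simp add: scalar_mult_eq_scaleR)
    qed
  qed
qed

text \<open>Applying \<open>P\<close> to the \<open>j\<close>-th basis vector exhibits column
  \<open>j\<close>, whose support must stay in \<open>J\<close> when \<open>j\<close> does.\<close>

lemma invariant_face_support_face_iff:
  fixes P :: "real^'n^'n"
  assumes P: "\<forall>i j. 0 \<le> P $ i $ j"
  shows "invariant_face P (support_face J) \<longleftrightarrow> access_closed P J"
proof
  assume inv: "invariant_face P (support_face J)"
  have "P $ i $ j = 0" if "i \<notin> J" "j \<in> J" for i j
  proof -
    have "axis j 1 \<in> support_face J"
      using that by (auto simp: support_face_iff axis_def)
    then have "P *v axis j 1 \<in> support_face J"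
      using inv by (auto simp: invariant_face_def)
    then show ?thesis
      using that by (auto simp: support_face_iff matrix_vector_mult_basis column_def)
  qed
  then show "access_closed P J"
    by (auto simp: initial_subset_iff[symmetric] initial_subset_def)
next
  assume "access_closed P J"
  then have 0: "P $ i $ j = 0" if "i \<notin> J" "j \<in> J" for i j
    using that has_access_arc access_closedD by metis
  have "P *v x \<in> support_face J" if x: "x \<in> support_face J" for x
  proof -
    have "P $ i $ j * x $ j = 0" if "i \<notin> J" for i j
      using 0[OF that, of j] x by (cases "j \<in> J") (auto simp: support_face_iff)
    then show ?thesis
      using P x by (auto simp: support_face_iff matrix_vector_mult_def intro!: sum_nonneg sum.neutral)
  qed
  then show "invariant_face P (support_face J)"
    by (auto simp: invariant_face_def orthant_face_support_face)
qed

lemma invariant_face_cases: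
  fixes P :: "real^'n^'n"
  assumes "\<forall>i j. 0 \<le> P $ i $ j" "invariant_face P F"
  obtains J where "F = support_face J" "access_closed P J"
  using assms invariant_face_support_face_iff orthant_face_cases
  by (metis invariant_face_def)

lemma face_join_support_face: "face_join (support_face J) (support_face K) = support_face (J \<union> K)"
  unfolding face_join_def
proof (intro equalityI Inter_greatest Inter_lower)
  show "support_face (J \<union> K) \<in> {H. orthant_face H \<and> support_face J \<union> support_face K \<subseteq> H}"
    by (auto simp: orthant_face_support_face support_face_mono_iff)
next
  fix H :: "(real^'a) set"
  assume H: "H \<in> {H. orthant_face H \<and> support_face J \<union> support_face K \<subseteq> H}"
  then obtain L where "H = support_face L"
    using orthant_face_cases by blast
  with H show "support_face (J \<union> K) \<subseteq> H"
    by (auto simp: support_face_mono_iff)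
qed

text \<open>Rests on the criterion that \<open>z\<close> is a relative interior point iff every
  segment from a point of the convex set to \<open>z\<close> can be prolonged beyond
  \<open>z\<close> within the set. Prolonging from the indicator vector of \<open>J\<close> forces
  positive coordinates on \<open>J\<close>.\<close>

lemma rel_interior_support_face:
  fixes J :: "'n::finite set"
  shows "rel_interior (support_face J) = {x. (\<forall>i\<in>J. 0 < x $ i) \<and> (\<forall>i. i \<notin> J \<longrightarrow> x $ i = 0)}"
    (is "_ = ?R")
proof -
  have cv: "convex (support_face J)" "support_face J \<noteq> {}"
    using convex_cone_support_face[of J] by (auto simp: convex_cone_def)
  have "z \<in> rel_interior (support_face J) \<longleftrightarrow> z \<in> ?R" for z
  proof
    assume z: "z \<in> rel_interior (support_face J)"
    have zs: "z \<in> support_face J" using z rel_interior_subset by blast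
    have "0 < z $ i" if i: "i \<in> J" for i
    proof -
      obtain e where e: "e > 1"
        "(1 - e) *\<^sub>R (\<chi> i. if i \<in> J then 1 else 0) + e *\<^sub>R z \<in> support_face J"
        using z convex_rel_interior_iff[OF cv] indicator_mem_support_face by blast
      then have "0 \<le> (1 - e) + e * z $ i"
        using i by (auto simp: support_face_iff dest!: spec[of _ i])
      then have "0 < e * z $ i" using e by linarith
      then show ?thesis using e by (simp add: zero_less_mult_iff)
    qed
    then show "z \<in> ?R" using zs by (auto simp: support_face_iff)
  next
    assume z: "z \<in> ?R"
    \<comment> \<open>At \<open>e = 1\<close> the combination is \<open>z\<close>; by continuity
      each of the finitely many coordinates stays nonnegative for \<open>e\<close> slightly above 1,
      so one \<open>e\<close> serves them all.\<close>
    have "\<exists>e>1. (1 - e) *\<^sub>R x + e *\<^sub>R z \<in> support_face J" if x: "x \<in> support_face J" for x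
    proof -
      have "\<forall>\<^sub>F e in at_right (1::real). \<forall>i. 0 \<le> (1 - e) * x $ i + e * z $ i"
      proof (rule eventually_all_finite)
        fix i
        show "\<forall>\<^sub>F e in at_right (1::real). 0 \<le> (1 - e) * x $ i + e * z $ i"
        proof (cases "i \<in> J")
          case True
          have "((\<lambda>e. (1 - e) * x $ i + e * z $ i) \<longlongrightarrow> (1 - 1) * x $ i + 1 * z $ i) (at_right (1::real))"
            by (intro tendsto_intros)
          then have "\<forall>\<^sub>F e in at_right (1::real). 0 < (1 - e) * x $ i + e * z $ i"
            using z True by (intro order_tendstoD(1)) auto
          then show ?thesis by eventually_elim simp
        next
          case False
          then show ?thesis using x z by (simp add: support_face_iff)
        qed
      qed
      moreover have "\<forall>\<^sub>F e in at_right (1::real). 1 < e"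
        by (simp add: eventually_at_right_less)
      ultimately have "\<forall>\<^sub>F e in at_right (1::real). e > 1 \<and> (\<forall>i. 0 \<le> (1 - e) * x $ i + e * z $ i)"
        by eventually_elim simp
      then obtain e where "e > 1" "\<forall>i. 0 \<le> (1 - e) * x $ i + e * z $ i"
        using eventually_happens'[OF trivial_limit_at_right_real] by blast
      then show ?thesis
        using x z by (intro exI[of _ e]) (auto simp: support_face_iff)
    qed
    then show "z \<in> rel_interior (support_face J)"
      using convex_rel_interior_iff[OF cv] by blast
  qed
  then show ?thesis by blast
qed

section \<open>Minimal and join-irreducible invariant faces\<close>

text \<open>Minimality says that \<open>I\<close> has no nonempty closed proper subset. Applied to
  the set of indices with access to a given \<open>k\<close> in \<open>I\<close>, this makes all
  elements of \<open>I\<close> mutually accessible.\<close>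

lemma minimal_nonzero_invariant_face_iff:
  fixes P :: "real^'n^'n"
  assumes P: "\<forall>i j. 0 \<le> P $ i $ j" and I: "access_closed P I"
  shows "minimal_nonzero_invariant_face P (support_face I) \<longleftrightarrow> initial_class P I"
proof
  assume min: "minimal_nonzero_invariant_face P (support_face I)"
  then have "I \<noteq> {}"
    by (auto simp: minimal_nonzero_invariant_face_def support_face_empty)
  then obtain i where i: "i \<in> I" by blast
  have eq: "J = I" if "access_closed P J" "J \<noteq> {}" "J \<subseteq> I" for J
    using min that P unfolding minimal_nonzero_invariant_face_def
    by (metis invariant_face_support_face_iff support_face_eq_iff support_face_mono_iff support_face_empty)
  have acc: "has_access P j k" if "j \<in> I" "k \<in> I" for j k
  proof -
    have "{j. has_access P j k} \<subseteq> I" using access_closedD[OF I _ \<open>k \<in> I\<close>] by blast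
    then have "{j. has_access P j k} = I"
      using eq access_closed_access_set has_access_refl by (metis empty_iff mem_Collect_eq)
    with that show ?thesis by blast
  qed
  have "I = class_of P i"
    using i acc access_closedD[OF I] by (auto simp: class_of_def)
  moreover have "\<not> class_access P \<beta> I" if "\<beta> \<in> classes P" "\<beta> \<noteq> I" for \<beta>
  proof
    assume "class_access P \<beta> I"
    then obtain b where "b \<in> \<beta>" "b \<in> I"
      using access_closedD[OF I] by (auto simp: class_access_def)
    then show False
      using that calculation class_of_eqI class_of_in_classes by metis
  qed
  ultimately show "initial_class P I"
    by (metis initial_class_def class_of_in_classes)
next
  assume ini: "initial_class P I"
  then have cl: "I \<in> classes P" by (simp add: initial_class_def)
  have "J = I" if J: "access_closed P J" "J \<noteq> {}" "J \<subseteq> I" for J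
  proof -
    obtain j where "j \<in> J" using J by blast
    then show ?thesis
      using J class_subset_closed[OF J(1) cl] by blast
  qed
  moreover have "I \<noteq> {}" using class_nonempty[OF cl] by blast
  ultimately show "minimal_nonzero_invariant_face P (support_face I)"
    unfolding minimal_nonzero_invariant_face_def
    using P I by (metis invariant_face_cases invariant_face_support_face_iff
      support_face_eq_zero_iff support_face_mono_iff)
qed

text \<open>In terms of closed sets, irreducibility says that \<open>I\<close> is not the union of
  two closed proper subsets. If \<open>I\<close> is determined by a class, the part of a union that
  contains the representative \<open>a\<close> already contains all of \<open>I\<close>.\<close>

lemma join_irreducible_face_iff:
  fixes P :: "real^'n^'n"
  assumes P: "\<forall>i j. 0 \<le> P $ i $ j" and I: "access_closed P I" "I \<noteq> {}"
  shows "join_irreducible_face P (support_face I) \<longleftrightarrow> (\<exists>\<alpha>. determined_by P I \<alpha>)"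
proof
  assume irr: "join_irreducible_face P (support_face I)"
  have split: "J = I \<or> K = I" if "access_closed P J" "access_closed P K" "J \<union> K = I" for J K
  proof (rule ccontr)
    assume "\<not> ?thesis"
    then have "J \<subset> I" "K \<subset> I" using that by auto
    then have "support_face J \<subset> support_face I" "support_face K \<subset> support_face I"
      by (auto simp: less_le support_face_mono_iff support_face_eq_iff)
    then show False
      using irr that P unfolding join_irreducible_face_def
      by (metis invariant_face_support_face_iff face_join_support_face)
  qed
  obtain i where "i \<in> I" using I by blast
  then obtain j where j: "j \<in> I"
    "\<And>k. k \<in> I \<Longrightarrow> has_access P j k \<Longrightarrow> has_access P k j"
    using exists_final_index[of i I P] by blast
  \<comment> \<open>Two closed sets covering \<open>I\<close>. The second is closed because
    \<open>j\<close> is terminal in \<open>I\<close>, and it omits \<open>j\<close>, so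
    irreducibility leaves only \<open>?J = I\<close>.\<close>
  let ?J = "{k. has_access P k j}" and ?K = "I - class_of P j"
  have "access_closed P ?K"
    unfolding access_closed_def
  proof (intro allI impI)
    fix k l assume kl: "has_access P k l" "l \<in> ?K"
    then have "k \<in> I" using access_closedD[OF I(1)] by blast
    moreover have "k \<notin> class_of P j"
    proof
      assume "k \<in> class_of P j"
      then have "has_access P j l" using kl by (auto simp: class_of_def intro: has_access_trans)
      then show False using kl j by (auto simp: class_of_def)
    qed
    ultimately show "k \<in> ?K" by blast
  qed
  moreover have "?J \<union> ?K = I"
    using access_closedD[OF I(1) _ j(1)] by (auto simp: class_of_def)
  moreover have "?K \<noteq> I" using j(1) mem_class_of_self[of j P] by blast
  ultimately have "I = ?J"
    using split[OF access_closed_access_set] by blast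
  then show "\<exists>\<alpha>. determined_by P I \<alpha>"
    using determined_by_iff[OF class_of_in_classes mem_class_of_self] by blast
next
  assume "\<exists>\<alpha>. determined_by P I \<alpha>"
  then obtain \<alpha> where \<alpha>: "determined_by P I \<alpha>" by blast
  then have cl: "\<alpha> \<in> classes P" by (simp add: determined_by_def)
  then obtain a where a: "a \<in> \<alpha>" using class_nonempty by blast
  have Ia: "I = {i. has_access P i a}"
    using determined_by_iff[OF cl a] \<alpha> by simp
  have split: "J = I \<or> K = I" if "access_closed P J" "access_closed P K" "J \<union> K = I" for J K
  proof -
    have "a \<in> J \<or> a \<in> K" using that Ia by auto
    then show ?thesis
      using that Ia by (auto dest: access_closedD)
  qed
  have "\<not> (\<exists>G H. invariant_face P G \<and> invariant_face P H \<and> G \<subset> support_face I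
      \<and> H \<subset> support_face I \<and> support_face I = face_join G H)"
  proof
    assume "\<exists>G H. invariant_face P G \<and> invariant_face P H \<and> G \<subset> support_face I
      \<and> H \<subset> support_face I \<and> support_face I = face_join G H"
    then obtain G H where GH: "invariant_face P G" "invariant_face P H" "G \<subset> support_face I"
      "H \<subset> support_face I" "support_face I = face_join G H" by blast
    obtain J where J: "G = support_face J" "access_closed P J"
      using invariant_face_cases[OF P GH(1)] .
    obtain K where K: "H = support_face K" "access_closed P K"
      using invariant_face_cases[OF P GH(2)] .
    have "J \<union> K = I"
      using GH J K by (simp add: face_join_support_face support_face_eq_iff)
    then show False
      using split[OF J(2) K(2)] J(1) K(1) GH(3,4) by auto
  qed
  then show "join_irreducible_face P (support_face I)"
    using I P by (simp add: join_irreducible_face_def invariant_face_support_face_iff)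
qed

section \<open>Perron vectors of classes\<close>

text \<open>Brouwer's theorem on the simplex of vectors supported on \<open>S\<close>, for the
  normalised map \<open>x + P_SS x\<close>; a fixed point with normalising sum \<open>t\<close> is
  an eigenvector for \<open>t - 1\<close>.\<close>

lemma nonneg_eigenvector_exists:
  fixes P :: "real^'n^'n" and S :: "'n set"
  assumes P: "\<forall>i j. 0 \<le> P $ i $ j" and S: "S \<noteq> {}"
  obtains x :: "real^'n" and r where "\<And>i. 0 \<le> x $ i" "\<And>i. i \<notin> S \<Longrightarrow> x $ i = 0" "x \<noteq> 0" "0 \<le> r"
    "\<And>i. i \<in> S \<Longrightarrow> (\<Sum>j\<in>S. P $ i $ j * x $ j) = r * x $ i"
proof -
  define D where "D = {x :: real^'n. (\<forall>i. 0 \<le> x $ i) \<and> (\<forall>i. i \<notin> S \<longrightarrow> x $ i = 0) \<and> (\<Sum>i\<in>UNIV. x $ i) = 1}"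
  \<comment> \<open>The summand \<open>x\<close> keeps the normalising sum \<open>t x\<close> at
    least 1, so the division is safe even where the block of \<open>P\<close> annihilates
    \<open>x\<close>.\<close>
  define g where "g = (\<lambda>x :: real^'n. \<chi> i. x $ i + (if i \<in> S then \<Sum>j\<in>S. P $ i $ j * x $ j else 0))"
  define t where "t = (\<lambda>x. \<Sum>i\<in>UNIV. g x $ i)"
  have t: "1 \<le> t x" if "x \<in> D" for x
  proof -
    have "(\<Sum>i\<in>UNIV. x $ i) \<le> t x"
      using that P unfolding t_def g_def D_def by (intro sum_mono) (auto intro!: sum_nonneg)
    then show ?thesis using that by (simp add: D_def)
  qed
  have "D \<subseteq> cbox 0 1"
  proof
    fix x assume x: "x \<in> D"
    have "x $ i \<le> (\<Sum>i\<in>UNIV. x $ i)" for i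
      using x by (intro member_le_sum) (auto simp: D_def)
    with x show "x \<in> cbox 0 1"
      by (auto simp: D_def mem_box_cart)
  qed
  moreover have "closed D"
    unfolding D_def
    by (intro closed_Collect_conj closed_Collect_all closed_Collect_imp closed_Collect_le
        closed_Collect_eq continuous_intros) auto
  ultimately have "compact D"
    by (metis bounded_cbox bounded_subset compact_eq_bounded_closed)
  moreover have "convex D"
    unfolding D_def convex_def
    by (simp add: sum.distrib flip: sum_distrib_left)
  moreover obtain a where "a \<in> S" using S by blast
  then have "axis a 1 \<in> D"
    by (auto simp: D_def axis_def)
  then have "D \<noteq> {}" by blast
  moreover have "continuous_on D (\<lambda>x. (1 / t x) *\<^sub>R g x)"
  proof -
    have "continuous_on D (\<lambda>x. g x $ i)" for i
      unfolding g_def by (cases "i \<in> S") (auto intro!: continuous_intros)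
    then have "continuous_on D (\<lambda>x. \<chi> i. g x $ i)"
      by (rule continuous_on_vec_lambda)
    then have "continuous_on D g" by simp
    moreover from this have "continuous_on D t"
      unfolding t_def by (intro continuous_intros)
    moreover have "\<forall>x\<in>D. t x \<noteq> 0"
      using t by fastforce
    ultimately show ?thesis
      by (intro continuous_intros)
  qed
  moreover have "(\<lambda>x. (1 / t x) *\<^sub>R g x) \<in> D \<rightarrow> D"
  proof
    fix x assume x: "x \<in> D"
    have "0 \<le> g x $ i" "i \<notin> S \<longrightarrow> g x $ i = 0" for i
      using x P by (auto simp: g_def D_def intro!: add_nonneg_nonneg sum_nonneg)
    moreover have "(\<Sum>i\<in>UNIV. ((1 / t x) *\<^sub>R g x) $ i) = 1"
      using t[OF x] by (simp add: t_def sum_divide_distrib[symmetric])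
    ultimately show "(1 / t x) *\<^sub>R g x \<in> D"
      using t[OF x] by (simp add: D_def)
  qed
  ultimately obtain x where x: "x \<in> D" "(1 / t x) *\<^sub>R g x = x"
    using brouwer by blast
  have "t x *\<^sub>R ((1 / t x) *\<^sub>R g x) = g x"
    using t[OF x(1)] by simp
  then have g: "g x = t x *\<^sub>R x"
    by (simp only: x(2))
  have "(\<Sum>j\<in>S. P $ i $ j * x $ j) = (t x - 1) * x $ i" if "i \<in> S" for i
    using arg_cong[OF g, of "\<lambda>y. y $ i"] that by (simp add: g_def algebra_simps)
  moreover have "x \<noteq> 0" using x(1) by (auto simp: D_def)
  ultimately show ?thesis
    using that[of x "t x - 1"] x(1) t[OF x(1)] by (auto simp: D_def)
qed

text \<open>Positivity spreads backwards along arcs from an index where the eigenvector is nonzero,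
  and within a class this reaches every index.\<close>

lemma class_positive_eigenvector_exists:
  fixes P :: "real^'n^'n"
  assumes P: "\<forall>i j. 0 \<le> P $ i $ j" and \<beta>: "\<beta> \<in> classes P"
  obtains x :: "real^'n" and r where "\<And>i. i \<in> \<beta> \<Longrightarrow> 0 < x $ i" "\<And>i. i \<notin> \<beta> \<Longrightarrow> x $ i = 0" "0 \<le> r"
    "\<And>i. i \<in> \<beta> \<Longrightarrow> (\<Sum>j\<in>\<beta>. P $ i $ j * x $ j) = r * x $ i"
proof -
  have ne: "\<beta> \<noteq> {}" using class_nonempty[OF \<beta>] by blast
  obtain x :: "real^'n" and r where x: "\<And>i. 0 \<le> x $ i" "\<And>i. i \<notin> \<beta> \<Longrightarrow> x $ i = 0" "x \<noteq> 0"
    "0 \<le> r" "\<And>i. i \<in> \<beta> \<Longrightarrow> (\<Sum>j\<in>\<beta>. P $ i $ j * x $ j) = r * x $ i"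
    using nonneg_eigenvector_exists[OF P ne] by blast
  obtain j where j: "x $ j \<noteq> 0" using x(3) by (auto simp: vec_eq_iff)
  then have j\<beta>: "j \<in> \<beta>" using x(2) by blast
  have "i \<in> \<beta> \<longrightarrow> 0 < x $ i" if "(i, j) \<in> (arcs P)\<^sup>*" for i
    using that
  proof (induction rule: converse_rtrancl_induct)
    case base
    then show ?case using j x(1)[of j] by simp
  next
    case (step i k)
    show ?case
    proof
      assume i: "i \<in> \<beta>"
      have ik: "P $ i $ k \<noteq> 0" using step by (simp add: arcs_def)
      have "has_access P k j" using step by (simp add: has_access_def)
      \<comment> \<open>\<open>k\<close> lies on a path between two elements of \<beta>, hence in
        \<beta> itself.\<close>
      then have "k \<in> \<beta>"
        using \<beta> i j\<beta> has_access_arc[OF ik] class_has_access class_memI has_access_trans by metis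
      then have "0 < P $ i $ k * x $ k"
        using step P ik by (simp add: less_le)
      also have "\<dots> \<le> (\<Sum>k\<in>\<beta>. P $ i $ k * x $ k)"
        using \<open>k \<in> \<beta>\<close> P x(1) by (intro member_le_sum) auto
      finally have "0 < r * x $ i" using x(5)[OF i] by simp
      then show "0 < x $ i" using x(1)[of i] x(4) by (simp add: zero_less_mult_iff)
    qed
  qed
  then have "0 < x $ i" if "i \<in> \<beta>" for i
    using class_has_access[OF \<beta> that j\<beta>] that by (simp add: has_access_def)
  then show ?thesis using that x by blast
qed

text \<open>The right and left eigenvalues agree because the pairing of the two positive vectors is
  positive. For a complex eigenvalue, passing to moduli in the eigenvector equation and pairing with
  \<open>v\<close> bounds its modulus by the same number, which therefore is the supremum defining
  the spectral radius.\<close>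

lemma class_perron:
  fixes P :: "real^'n^'n"
  assumes P: "\<forall>i j. 0 \<le> P $ i $ j" and \<beta>: "\<beta> \<in> classes P"
  obtains u v :: "real^'n" where
    "\<And>i. i \<in> \<beta> \<Longrightarrow> 0 < u $ i" "\<And>i. i \<notin> \<beta> \<Longrightarrow> u $ i = 0"
    "\<And>i. i \<in> \<beta> \<Longrightarrow> (\<Sum>j\<in>\<beta>. P $ i $ j * u $ j) = sub_spectral_radius P \<beta> * u $ i"
    "\<And>j. j \<in> \<beta> \<Longrightarrow> 0 < v $ j" "\<And>j. j \<notin> \<beta> \<Longrightarrow> v $ j = 0"
    "\<And>j. j \<in> \<beta> \<Longrightarrow> (\<Sum>i\<in>\<beta>. v $ i * P $ i $ j) = sub_spectral_radius P \<beta> * v $ j"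
    "0 \<le> sub_spectral_radius P \<beta>"
    "\<And>z. z \<in> sub_spectrum P \<beta> \<Longrightarrow> cmod z \<le> sub_spectral_radius P \<beta>"
proof -
  obtain u :: "real^'n" and r where u: "\<And>i. i \<in> \<beta> \<Longrightarrow> 0 < u $ i" "\<And>i. i \<notin> \<beta> \<Longrightarrow> u $ i = 0"
    "0 \<le> r" "\<And>i. i \<in> \<beta> \<Longrightarrow> (\<Sum>j\<in>\<beta>. P $ i $ j * u $ j) = r * u $ i"
    using class_positive_eigenvector_exists[OF P \<beta>] by blast
  \<comment> \<open>The left vector is a right vector of the transpose, which has the same
    classes.\<close>
  have PT: "\<forall>i j. 0 \<le> transpose P $ i $ j" using P by (simp add: transpose_def)
  have \<beta>T: "\<beta> \<in> classes (transpose P)" using \<beta> by (simp add: classes_transpose)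
  obtain v :: "real^'n" and s where v: "\<And>i. i \<in> \<beta> \<Longrightarrow> 0 < v $ i" "\<And>i. i \<notin> \<beta> \<Longrightarrow> v $ i = 0"
    "0 \<le> s" "\<And>i. i \<in> \<beta> \<Longrightarrow> (\<Sum>j\<in>\<beta>. transpose P $ i $ j * v $ j) = s * v $ i"
    using class_positive_eigenvector_exists[OF PT \<beta>T] by blast
  have v4: "(\<Sum>i\<in>\<beta>. v $ i * P $ i $ j) = s * v $ j" if "j \<in> \<beta>" for j
    using v(4)[OF that] by (simp add: transpose_def mult.commute)
  obtain a where a: "a \<in> \<beta>" using class_nonempty[OF \<beta>] by blast
  have pair: "(\<Sum>i\<in>\<beta>. v $ i * (\<Sum>j\<in>\<beta>. P $ i $ j * y j)) = s * (\<Sum>j\<in>\<beta>. v $ j * y j)" for y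
  proof -
    have "(\<Sum>i\<in>\<beta>. v $ i * (\<Sum>j\<in>\<beta>. P $ i $ j * y j)) = (\<Sum>j\<in>\<beta>. (\<Sum>i\<in>\<beta>. v $ i * P $ i $ j) * y j)"
      unfolding sum_distrib_left sum_distrib_right by (subst sum.swap) (simp add: mult.assoc)
    also have "\<dots> = (\<Sum>j\<in>\<beta>. s * (v $ j * y j))"
      by (rule sum.cong) (simp_all add: v4 mult.assoc)
    finally show ?thesis by (simp add: sum_distrib_left)
  qed
  have "0 < (\<Sum>i\<in>\<beta>. v $ i * u $ i)"
    using a u v by (intro sum_pos) auto
  moreover have "s * (\<Sum>i\<in>\<beta>. v $ i * u $ i) = r * (\<Sum>i\<in>\<beta>. v $ i * u $ i)"
    unfolding pair[symmetric] by (simp add: u(4) sum_distrib_left mult.left_commute)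
  ultimately have sr: "s = r" by simp
  have le: "cmod z \<le> r" if z: "z \<in> sub_spectrum P \<beta>" for z
  proof -
    obtain x :: "'n \<Rightarrow> complex" and b where b: "b \<in> \<beta>" "x b \<noteq> 0"
      and x: "\<And>i. i \<in> \<beta> \<Longrightarrow> (\<Sum>j\<in>\<beta>. complex_of_real (P $ i $ j) * x j) = z * x i"
      using z unfolding sub_spectrum_def by blast
    have "cmod z * cmod (x i) \<le> (\<Sum>j\<in>\<beta>. P $ i $ j * cmod (x j))" if "i \<in> \<beta>" for i
    proof -
      have "cmod z * cmod (x i) = cmod (\<Sum>j\<in>\<beta>. complex_of_real (P $ i $ j) * x j)"
        by (simp add: x[OF that] norm_mult)
      also have "\<dots> \<le> (\<Sum>j\<in>\<beta>. cmod (complex_of_real (P $ i $ j) * x j))"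
        by (rule norm_sum)
      finally show ?thesis using P by (simp add: norm_mult)
    qed
    then have "(\<Sum>i\<in>\<beta>. v $ i * (cmod z * cmod (x i))) \<le> (\<Sum>i\<in>\<beta>. v $ i * (\<Sum>j\<in>\<beta>. P $ i $ j * cmod (x j)))"
      using v(1) by (intro sum_mono mult_left_mono) (auto intro: less_imp_le)
    then have "cmod z * (\<Sum>i\<in>\<beta>. v $ i * cmod (x i)) \<le> s * (\<Sum>i\<in>\<beta>. v $ i * cmod (x i))"
      unfolding pair by (simp add: sum_distrib_left mult.left_commute)
    moreover have "0 < (\<Sum>i\<in>\<beta>. v $ i * cmod (x i))"
      using b v(1) by (intro sum_pos2[of _ b]) (auto simp: less_imp_le)
    ultimately show ?thesis by (simp add: sr)
  qed
  have "complex_of_real r \<in> sub_spectrum P \<beta>"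
    unfolding sub_spectrum_def mem_Collect_eq
  proof (intro exI[of _ "\<lambda>i. complex_of_real (u $ i)"] conjI ballI)
    show "\<exists>i\<in>\<beta>. complex_of_real (u $ i) \<noteq> 0" using a u(1)[OF a] by (intro bexI[of _ a]) auto
    show "(\<Sum>j\<in>\<beta>. complex_of_real (P $ i $ j) * complex_of_real (u $ j)) =
      complex_of_real r * complex_of_real (u $ i)" if "i \<in> \<beta>" for i
      unfolding of_real_mult[symmetric] of_real_sum[symmetric] by (simp add: u(4)[OF that])
  qed
  then have "sub_spectral_radius P \<beta> = r"
    unfolding sub_spectral_radius_def using le u(3) by (intro cSup_eq_maximum) (auto simp: image_iff intro!: bexI[of _ "complex_of_real r"])
  then show ?thesis
    using that[of u v] u v v4 le sr by blast
qed

section \<open>Decay of the iterates of a complex matrix\<close>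

text \<open>From some \<open>N\<close> on, \<open>e m\<close> stays below
  \<open>\<epsilon> / 2 * (1 - q)\<close>. Since \<open>\<epsilon> / 2\<close> is the fixed point of
  \<open>t \<mapsto> q * t + \<epsilon> / 2 * (1 - q)\<close>, the tail is at most
  \<open>\<epsilon> / 2\<close> plus a geometrically decaying term.\<close>

lemma contraction_tendsto_zero:
  fixes c e :: "nat \<Rightarrow> real"
  assumes q: "0 \<le> q" "q < 1" and c: "\<And>m. 0 \<le> c m" "\<And>m. c (Suc m) \<le> q * c m + e m"
    and e: "e \<longlonglongrightarrow> 0"
  shows "c \<longlonglongrightarrow> 0"
proof (rule LIMSEQ_I)
  fix \<epsilon> :: real assume "0 < \<epsilon>"
  then have "\<forall>\<^sub>F m in sequentially. e m < \<epsilon> / 2 * (1 - q)"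
    using q by (intro order_tendstoD(2)[OF e]) auto
  then obtain N where N: "\<And>m. N \<le> m \<Longrightarrow> e m < \<epsilon> / 2 * (1 - q)"
    by (auto simp: eventually_sequentially)
  have bound: "c (N + k) \<le> q ^ k * c N + \<epsilon> / 2" for k
  proof (induction k)
    case (Suc k)
    have "c (N + Suc k) \<le> q * c (N + k) + e (N + k)"
      using c(2) by simp
    also have "\<dots> \<le> q * (q ^ k * c N + \<epsilon> / 2) + \<epsilon> / 2 * (1 - q)"
      using q Suc N[of "N + k"] by (intro add_mono mult_left_mono) auto
    also have "\<dots> = q ^ Suc k * c N + \<epsilon> / 2"
      by (simp add: field_simps)
    finally show ?case .
  qed (use \<open>0 < \<epsilon>\<close> in simp)
  have "(\<lambda>k. q ^ k * c N) \<longlonglongrightarrow> 0 * c N"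
    using q by (intro tendsto_intros LIMSEQ_realpow_zero)
  then have "\<forall>\<^sub>F k in sequentially. q ^ k * c N < \<epsilon> / 2"
    using \<open>0 < \<epsilon>\<close> by (intro order_tendstoD(2)) auto
  then obtain K where K: "\<And>k. K \<le> k \<Longrightarrow> q ^ k * c N < \<epsilon> / 2"
    by (auto simp: eventually_sequentially)
  have "norm (c m - 0) < \<epsilon>" if m: "N + K \<le> m" for m
  proof -
    have "N + (m - N) = m" "K \<le> m - N" using m by auto
    then have "c m < \<epsilon> / 2 + \<epsilon> / 2"
      using bound[of "m - N"] K[of "m - N"] by (auto simp del: field_sum_of_halves)
    then show ?thesis using c(1)[of m] by simp
  qed
  then show "\<exists>no. \<forall>m\<ge>no. norm (c m - 0) < \<epsilon>" by blast
qed

text \<open>Dividing by \<open>r ^ m\<close> and taking moduli gives a contraction with factor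
  \<open>cmod \<mu> / r\<close> and a vanishing perturbation.\<close>

lemma linear_recurrence_tendsto_zero:
  fixes a b :: "nat \<Rightarrow> complex"
  assumes a: "\<And>m. a (Suc m) = \<mu> * a m + b m" and \<mu>: "cmod \<mu> < r"
    and b: "(\<lambda>m. b m / of_real r ^ m) \<longlonglongrightarrow> 0"
  shows "(\<lambda>m. a m / of_real r ^ m) \<longlonglongrightarrow> 0"
proof -
  have r: "0 < r" using \<mu> norm_ge_zero[of \<mu>] by linarith
  have "(\<lambda>m. cmod (a m / of_real r ^ m)) \<longlonglongrightarrow> 0"
  proof (rule contraction_tendsto_zero)
    show "0 \<le> cmod \<mu> / r" "cmod \<mu> / r < 1" using r \<mu> by auto
    show "(\<lambda>m. cmod (b m / of_real r ^ m) / r) \<longlonglongrightarrow> 0"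
      using tendsto_divide[OF tendsto_norm_zero[OF b] tendsto_const[of r]] r by simp
    fix m
    have "a (Suc m) / of_real r ^ Suc m
        = \<mu> / of_real r * (a m / of_real r ^ m) + b m / of_real r ^ m / of_real r"
      using r by (simp add: a field_simps)
    then have "cmod (a (Suc m) / of_real r ^ Suc m)
        \<le> cmod (\<mu> / of_real r * (a m / of_real r ^ m)) + cmod (b m / of_real r ^ m / of_real r)"
      using norm_triangle_ineq by metis
    then show "cmod (a (Suc m) / of_real r ^ Suc m)
        \<le> cmod \<mu> / r * cmod (a m / of_real r ^ m) + cmod (b m / of_real r ^ m) / r"
      using r by (simp add: norm_mult norm_divide)
  qed simp
  then show ?thesis by (rule tendsto_norm_zero_cancel)
qed

section \<open>Polynomials in a matrix acting on a vector\<close>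

definition poly_act :: "complex^'n^'n \<Rightarrow> complex poly \<Rightarrow> complex^'n \<Rightarrow> complex^'n" where
  "poly_act M p w = (\<Sum>i\<le>degree p. coeff p i *s ((*v) M ^^ i) w)"

text \<open>Padding with zero coefficients lets polynomials of different degrees be handled over one
  index range.\<close>

lemma poly_act_eq: "degree p \<le> N \<Longrightarrow> poly_act M p w = (\<Sum>i\<le>N. coeff p i *s ((*v) M ^^ i) w)"
  unfolding poly_act_def by (rule sum.mono_neutral_left) (auto simp: coeff_eq_0)

lemma poly_act_add: "poly_act M (p + q) w = poly_act M p w + poly_act M q w"
proof -
  define N where "N = max (degree p) (degree q)"
  have "degree (p + q) \<le> N" by (simp add: N_def degree_add_le_max)
  then show ?thesis
    by (simp add: poly_act_eq[of _ N] N_def vec.scale_left_distrib sum.distrib)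
qed

lemma poly_act_smult: "poly_act M (smult c p) w = c *s poly_act M p w"
  using poly_act_eq[of "smult c p" "degree p" M w]
  by (simp add: poly_act_def vec.scale_sum_right vector_smult_assoc degree_smult_le)

lemma poly_act_pCons: "poly_act M (pCons c p) w = c *s w + poly_act M p (M *v w)"
proof -
  have "degree (pCons c p) \<le> Suc (degree p)" by (rule degree_pCons_le)
  then have "poly_act M (pCons c p) w = (\<Sum>i\<le>Suc (degree p). coeff (pCons c p) i *s ((*v) M ^^ i) w)"
    by (rule poly_act_eq)
  also have "\<dots> = c *s w + (\<Sum>i\<le>degree p. coeff p i *s ((*v) M ^^ i) (M *v w))"
    by (subst sum.atMost_Suc_shift) (simp add: funpow_swap1)
  finally show ?thesis by (simp add: poly_act_def)
qed

lemma funpow_mult_vec_diff: "((*v) (M :: complex^'n^'n) ^^ i) (x - y) = ((*v) M ^^ i) x - ((*v) M ^^ i) y"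
  by (induction i) (simp_all add: matrix_vector_mult_diff_distrib)

lemma funpow_mult_vec_scale: "((*v) (M :: complex^'n^'n) ^^ i) (c *s x) = c *s ((*v) M ^^ i) x"
  by (induction i) (simp_all add: vector_scalar_commute)

lemma poly_act_diff_arg: "poly_act M p (x - y) = poly_act M p x - poly_act M p y"
  by (simp add: poly_act_def funpow_mult_vec_diff vec.scale_left_diff_distrib vec.scale_right_diff_distrib sum_subtractf)

lemma poly_act_scale_arg: "poly_act M p (c *s x) = c *s poly_act M p x"
  by (simp add: poly_act_def funpow_mult_vec_scale vector_smult_assoc vec.scale_sum_right mult.commute)

lemma poly_act_mult_arg: "poly_act M p (M *v w) = M *v poly_act M p w"
  by (simp add: poly_act_def vec.linear_sum[OF matrix_vector_mul_linear_gen] vector_scalar_commute funpow_swap1)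

text \<open>Moves a linear factor from the polynomial to the vector, which lowers the degree in the
  decay induction.\<close>

lemma poly_act_linear_factor: "poly_act M ([:- \<mu>, 1:] * p) w = poly_act M p (M *v w - \<mu> *s w)"
proof -
  have "[:- \<mu>, 1:] * p = smult (- \<mu>) p + pCons 0 p"
    by simp
  then have "poly_act M ([:- \<mu>, 1:] * p) w = (- \<mu>) *s poly_act M p w + poly_act M p (M *v w)"
    by (simp only: poly_act_add poly_act_smult poly_act_pCons) simp
  then show ?thesis
    by (simp add: poly_act_diff_arg poly_act_scale_arg)
qed

lemma of_real_scale_vec: "complex_of_real c *s x = c *\<^sub>R x"
  unfolding vec_eq_iff vector_smult_component vector_scaleR_component by (simp add: scaleR_conv_of_real)

lemma poly_act_monom: "poly_act M (monom c n) w = c *s ((*v) M ^^ n) w"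
proof -
  have "poly_act M (monom c n) w = (\<Sum>i\<le>n. coeff (monom c n) i *s ((*v) M ^^ i) w)"
    by (rule poly_act_eq) (rule degree_monom_le)
  also have "\<dots> = (\<Sum>i\<le>n. if i = n then c *s ((*v) M ^^ i) w else 0)"
    by (rule sum.cong) auto
  finally show ?thesis by simp
qed

lemma annihilating_poly_exists:
  fixes M :: "complex^'n^'n"
  obtains p where "p \<noteq> 0" "poly_act M p w = 0"
proof -
  define N where "N = DIM(complex^'n)"
  let ?f = "\<lambda>i. ((*v) M ^^ i) w"
  show ?thesis
  \<comment> \<open>Linear dependence is a property of sets, so a repetition among the iterates is
    treated separately: it gives a difference of two monomials. Otherwise \<open>N + 1\<close>
    distinct vectors exceed the real dimension.\<close>
  proof (cases "inj_on ?f {..N}")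
    case False
    then obtain i j where ij: "i \<noteq> j" "?f i = ?f j"
      by (auto simp: inj_on_def)
    have "poly_act M (monom 1 i + monom (-1) j) w = 0"
      by (simp add: poly_act_add poly_act_monom ij)
    moreover have "coeff (monom 1 i + monom (-1) j :: complex poly) i \<noteq> 0"
      using ij by simp
    then have "monom 1 i + monom (-1) j \<noteq> (0 :: complex poly)"
      by (metis coeff_0)
    ultimately show ?thesis using that by blast
  next
    case True
    then have "card (?f ` {..N}) > DIM(complex^'n)"
      by (simp add: card_image N_def)
    then have "dependent (?f ` {..N})"
      by (intro dependent_biggerset) auto
    then obtain u v where u: "v \<in> ?f ` {..N}" "u v \<noteq> 0" "(\<Sum>v\<in>?f ` {..N}. u v *\<^sub>R v) = 0"
      by (auto simp: dependent_finite)
    define p where "p = Poly (map (\<lambda>i. complex_of_real (u (?f i))) [0..<Suc N])"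
    have coeff: "coeff p i = (if i \<le> N then complex_of_real (u (?f i)) else 0)" for i
      by (simp add: p_def nth_default_def del: upt_Suc)
    have "degree p \<le> N"
      by (rule degree_le) (simp add: coeff)
    then have "poly_act M p w = (\<Sum>i\<le>N. u (?f i) *\<^sub>R ?f i)"
      by (simp add: poly_act_eq[of p N] coeff of_real_scale_vec)
    also have "\<dots> = (\<Sum>v\<in>?f ` {..N}. u v *\<^sub>R v)"
      by (simp add: sum.reindex[OF True])
    finally have "poly_act M p w = 0" using u by simp
    moreover obtain i where "i \<le> N" "v = ?f i" using u by auto
    then have "coeff p i \<noteq> 0" using u by (simp add: coeff)
    then have "p \<noteq> 0" by auto
    ultimately show ?thesis using that by blast
  qed
qed

text \<open>Induction on the degree of a polynomial annihilating \<open>w\<close>. With a root \<mu>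
  split off, the cofactor \<open>q\<close> annihilates \<open>M w - \<mu> w\<close>, which therefore
  decays. Either \<open>q\<close> annihilates \<open>w\<close> as well, or \<open>q(M) w\<close> is
  an eigenvector in \<open>W\<close> for \<mu>, so that \<open>cmod \<mu> < r\<close> and the scalar
  recurrence applies to each coordinate.\<close>

lemma power_iterates_decay:
  fixes M :: "complex^'n^'n" and W :: "(complex^'n) set"
  assumes diff: "\<And>x y. x \<in> W \<Longrightarrow> y \<in> W \<Longrightarrow> x - y \<in> W"
    and scale: "\<And>c x. x \<in> W \<Longrightarrow> c *s x \<in> W"
    and inv: "\<And>x. x \<in> W \<Longrightarrow> M *v x \<in> W"
    and eigen: "\<And>\<mu> z. z \<in> W \<Longrightarrow> z \<noteq> 0 \<Longrightarrow> M *v z = \<mu> *s z \<Longrightarrow> cmod \<mu> < r"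
    and w: "w \<in> W"
  shows "(\<lambda>m. ((*v) M ^^ m) w $ i / of_real r ^ m) \<longlonglongrightarrow> 0"
proof -
  have pow: "((*v) M ^^ i) x \<in> W" if "x \<in> W" for x i
    using that by (induction i) (auto intro: inv)
  have add: "x + y \<in> W" if "x \<in> W" "y \<in> W" for x y
    using diff[OF that(1) scale[OF that(2), of "-1"]] by simp
  have zero: "0 \<in> W" using diff[OF w w] by simp
  have act: "poly_act M p x \<in> W" if "x \<in> W" for p x
  proof -
    have "(\<Sum>i\<in>S. coeff p i *s ((*v) M ^^ i) x) \<in> W" for S
      by (induction S rule: infinite_finite_induct) (auto intro: zero add scale pow that)
    then show ?thesis by (simp add: poly_act_def)
  qed
  have "(\<lambda>m. ((*v) M ^^ m) w $ i / of_real r ^ m) \<longlonglongrightarrow> 0"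
    if "p \<noteq> 0" "poly_act M p w = 0" "w \<in> W" for p w
    using that
  proof (induction "degree p" arbitrary: p w)
    case 0
    then obtain c where "p = [:c:]" "c \<noteq> 0"
      by (metis degree_eq_zeroE pCons_0_0)
    then have "c *s w = 0"
      using 0 by (simp add: poly_act_def)
    then have "w = 0"
      using \<open>c \<noteq> 0\<close> by simp
    then show ?case
      using funpow_mult_vec_diff[of _ M 0 0] by simp
  next
    case (Suc d)
    have "\<not> constant (poly p)"
      using Suc.hyps(2) by (simp add: constant_degree)
    then obtain \<mu> where "poly p \<mu> = 0"
      using fundamental_theorem_of_algebra by blast
    then obtain q where p: "p = [:- \<mu>, 1:] * q"
      by (auto simp: poly_eq_0_iff_dvd elim: dvdE)
    have q: "q \<noteq> 0" "degree q = d"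
    proof -
      show "q \<noteq> 0" using p Suc.prems by auto
      then show "degree q = d" using p Suc.hyps(2) by (simp add: degree_mult_eq del: mult_pCons_left)
    qed
    let ?v = "M *v w - \<mu> *s w"
    have v: "poly_act M q ?v = 0" "?v \<in> W"
      using Suc.prems p by (auto simp: poly_act_linear_factor[symmetric] intro!: diff inv scale simp del: mult_pCons_left)
    have u: "M *v poly_act M q w = \<mu> *s poly_act M q w"
      using v(1) by (simp add: poly_act_diff_arg poly_act_scale_arg poly_act_mult_arg)
    show ?case
    proof (cases "poly_act M q w = 0")
      case True
      then show ?thesis using Suc.hyps(1)[of q w] q Suc.prems by simp
    next
      case False
      then have "cmod \<mu> < r" using eigen[OF act[OF Suc.prems(3)] _ u] by simp
      then show ?thesis
      proof (rule linear_recurrence_tendsto_zero[rotated])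
        show "(\<lambda>m. ((*v) M ^^ m) ?v $ i / of_real r ^ m) \<longlonglongrightarrow> 0"
          using Suc.hyps(1)[of q ?v] q v by simp
        show "((*v) M ^^ Suc m) w $ i = \<mu> * ((*v) M ^^ m) w $ i + ((*v) M ^^ m) ?v $ i" for m
          by (simp add: funpow_mult_vec_diff funpow_mult_vec_scale funpow_swap1)
      qed
    qed
  qed
  then show ?thesis
    using annihilating_poly_exists[of M w] w by metis
qed

section \<open>Fitting decomposition\<close>

lemma funpow_linear:
  fixes f :: "'a::real_vector \<Rightarrow> 'a"
  shows "linear f \<Longrightarrow> linear (f ^^ k)"
  by (induction k) (auto intro: linear_id linear_compose simp: id_def[symmetric])

text \<open>The first conclusion says that \<open>f\<close> is injective on the image of
  \<open>f ^^ k\<close> on \<open>V\<close>, the second that \<open>V\<close> is the sum of this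
  image and the kernel of \<open>f ^^ k\<close> in \<open>V\<close>. Once the kernels have
  stabilised, \<open>f ^^ k\<close> is injective on its own image, hence onto it by
  dimension.\<close>

lemma fitting_decomposition:
  fixes f :: "'a::euclidean_space \<Rightarrow> 'a"
  assumes f: "linear f" and V: "subspace V" "f ` V \<subseteq> V"
  obtains k where "\<And>z. z \<in> V \<Longrightarrow> f ((f ^^ k) z) = 0 \<Longrightarrow> (f ^^ k) z = 0"
    "\<And>w. w \<in> V \<Longrightarrow> \<exists>y\<in>V. (f ^^ k) (w - (f ^^ k) y) = 0"
proof -
  define K where "K k = {z \<in> V. (f ^^ k) z = 0}" for k
  have lin: "linear (f ^^ k)" for k using f by (rule funpow_linear)
  have inv: "(f ^^ k) z \<in> V" if "z \<in> V" for k z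
    using that V(2) by (induction k) auto
  have sub: "subspace (K k)" for k
    using V(1) by (auto simp: K_def subspace_def linear_0[OF lin] linear_add[OF lin] linear_scale[OF lin])
  have mono: "K k \<subseteq> K (k + j)" for k j
    unfolding K_def by (auto simp: funpow_add add.commute[of k] linear_0[OF lin])
  \<comment> \<open>The dimensions are bounded by that of the whole space, so some \<open>k\<close>
    attains the maximum, and the increasing kernels are constant from there on.\<close>
  have "\<exists>k. \<forall>j. dim (K j) \<le> dim (K k)"
    using ex_has_greatest_nat[of "\<lambda>_. True" 0 "\<lambda>k. dim (K k)" "DIM('a) + 1"]
    by (auto simp: less_Suc_eq_le dim_subset_UNIV)
  then obtain k where "\<And>j. dim (K j) \<le> dim (K k)" by blast
  then have stable: "K k = K (k + j)" for j
    by (intro subspace_dim_equal sub mono)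
  have 1: "(f ^^ k) z = 0" if "z \<in> V" "(f ^^ j) ((f ^^ k) z) = 0" for z j
    using stable[of j] that by (auto simp: K_def funpow_add add.commute[of k])
  have 2: "\<exists>y\<in>V. (f ^^ k) (w - (f ^^ k) y) = 0" if w: "w \<in> V" for w
  proof -
    let ?R = "(f ^^ k) ` V"
    have subR: "subspace ?R" "subspace ((f ^^ k) ` ?R)"
      by (intro linear_subspace_image lin V)+
    have inj: "inj_on (f ^^ k) ?R"
      using 1[of _ k] by (auto simp: linear_inj_on_iff_eq_0[OF lin subR(1)])
    have span: "span ?R = ?R"
      using subR(1) span_eq_iff by blast
    have "dim ((f ^^ k) ` ?R) = dim ?R"
      by (rule dim_image_eq) (simp_all only: lin span inj)
    moreover have "(f ^^ k) ` ?R \<subseteq> ?R"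
      using inv by auto
    ultimately have "(f ^^ k) ` ?R = ?R"
      by (intro subspace_dim_equal subR) auto
    then obtain y where "y \<in> V" "(f ^^ k) w = (f ^^ k) ((f ^^ k) y)"
      using w by blast
    then show ?thesis
      by (intro bexI[of _ y]) (simp_all add: linear_diff[OF lin])
  qed
  show ?thesis
    using that[OF 1[of _ 1] 2] by simp
qed

section \<open>Complexification and positivity\<close>

definition cmat :: "real^'n^'m \<Rightarrow> complex^'n^'m" where
  "cmat A = (\<chi> i j. complex_of_real (A $ i $ j))"

definition cvec :: "real^'n \<Rightarrow> complex^'n" where
  "cvec x = (\<chi> i. complex_of_real (x $ i))"

text \<open>Taking real parts commutes with real matrices, so decay and kernel relations obtained
  over the complex numbers descend to real vectors.\<close>

definition rvec :: "complex^'n \<Rightarrow> real^'n" where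
  "rvec z = (\<chi> i. Re (z $ i))"

lemma cmat_cvec: "cmat A *v cvec x = cvec (A *v x)"
  by (simp add: vec_eq_iff matrix_vector_mult_def cmat_def cvec_def)

lemma rvec_cmat: "rvec (cmat A *v z) = A *v rvec z"
  by (simp add: vec_eq_iff matrix_vector_mult_def cmat_def rvec_def)

lemma funpow_cmat_cvec: "((*v) (cmat A) ^^ k) (cvec x) = cvec (((*v) (A :: real^'n^'n) ^^ k) x)"
  by (induction k) (simp_all add: cmat_cvec)

lemma funpow_rvec_cmat: "rvec (((*v) (cmat A) ^^ k) z) = ((*v) (A :: real^'n^'n) ^^ k) (rvec z)"
  by (induction k) (simp_all add: rvec_cmat)

lemma rvec_cvec [simp]: "rvec (cvec x) = x"
  by (simp add: vec_eq_iff rvec_def cvec_def)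

lemma rvec_diff: "rvec (x - y) = rvec x - rvec y"
  by (simp add: vec_eq_iff rvec_def)

lemma cvec_eq_0_iff [simp]: "cvec x = 0 \<longleftrightarrow> x = 0"
  by (simp add: vec_eq_iff cvec_def)

lemma cmat_add_mat_1_mult: "cmat (P + mat 1) *v z = cmat P *v z + (z :: complex^'n)"
proof -
  have "cmat (P + mat 1) = cmat P + mat 1"
    by (simp add: vec_eq_iff cmat_def mat_def)
  then show ?thesis by (simp add: matrix_vector_mult_add_rdistrib)
qed

lemma shift_mult: "(lam *\<^sub>R mat 1 - P) *v x = lam *\<^sub>R x - P *v (x :: real^'n)"
  by (simp add: matrix_vector_mult_diff_rdistrib scaleR_matrix_vector_assoc[symmetric])

lemma cmat_shift_mult:
  "cmat (lam *\<^sub>R mat 1 - P) *v z = complex_of_real lam *s z - cmat P *v (z :: complex^'n)"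
proof -
  have "cmat (lam *\<^sub>R mat 1 - P) = lam *\<^sub>R mat 1 - cmat P"
    unfolding vec_eq_iff by (auto simp: cmat_def mat_def of_real_def scaleR_left_diff_distrib)
  moreover have "(lam *\<^sub>R mat 1) *v z = complex_of_real lam *s z"
  proof -
    have "(lam *\<^sub>R mat 1 :: complex^'n^'n) $ i $ j * z $ j = (if j = i then complex_of_real lam * z $ i else 0)" for i j
      by (simp add: mat_def of_real_def)
    then have "((lam *\<^sub>R mat 1) *v z) $ i = (\<Sum>j\<in>UNIV. if j = i then complex_of_real lam * z $ i else 0)" for i
      by (simp only: matrix_vector_mult_def vec_lambda_beta)
    then show ?thesis by (simp add: vec_eq_iff)
  qed
  ultimately show ?thesis
    by (simp add: matrix_vector_mult_diff_rdistrib)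
qed

text \<open>The coordinate subspace of \<open>S\<close>, without the sign condition of
  \<open>support_face\<close> and for real and complex scalars alike.\<close>

definition supported_on :: "'n set \<Rightarrow> ('a::zero^'n) set" where
  "supported_on S = {x. \<forall>i. i \<notin> S \<longrightarrow> x $ i = 0}"

lemma supported_onI: "(\<And>i. i \<notin> S \<Longrightarrow> x $ i = 0) \<Longrightarrow> x \<in> supported_on S"
  by (simp add: supported_on_def)

lemma supported_onD: "x \<in> supported_on S \<Longrightarrow> i \<notin> S \<Longrightarrow> x $ i = 0"
  by (simp add: supported_on_def)

lemma supported_on_diff: "x \<in> supported_on S \<Longrightarrow> y \<in> supported_on S \<Longrightarrow> x - y \<in> supported_on S"
  for x :: "'a::group_add^'n"
  by (simp add: supported_on_def)

lemma supported_on_scale: "x \<in> supported_on S \<Longrightarrow> c *s x \<in> supported_on S"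
  for x :: "'a::mult_zero^'n"
  by (simp add: supported_on_def)

lemma supported_on_scaleR: "x \<in> supported_on S \<Longrightarrow> c *\<^sub>R x \<in> supported_on S"
  for x :: "'a::real_vector^'n"
  by (simp add: supported_on_def)

lemma subspace_supported_on: "subspace (supported_on S :: ('a::real_vector^'n) set)"
  by (simp add: subspace_def supported_on_def)

lemma cvec_supported_on: "x \<in> supported_on S \<Longrightarrow> cvec x \<in> supported_on S"
  by (simp add: supported_on_def cvec_def)

lemma rvec_supported_on: "x \<in> supported_on S \<Longrightarrow> rvec x \<in> supported_on S"
  by (simp add: supported_on_def rvec_def)

lemma access_closed_zero: "access_closed P I \<Longrightarrow> i \<notin> I \<Longrightarrow> j \<in> I \<Longrightarrow> P $ i $ j = 0"
  using has_access_arc access_closedD by metis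

lemma mult_supported_on:
  assumes "access_closed P I" "x \<in> supported_on I"
  shows "P *v x \<in> supported_on I"
proof (rule supported_onI)
  fix i assume i: "i \<notin> I"
  have "P $ i $ j * x $ j = 0" for j
    using access_closed_zero[OF assms(1) i, of j] supported_onD[OF assms(2), of j] by (cases "j \<in> I") auto
  then have "(\<Sum>j\<in>UNIV. P $ i $ j * x $ j) = 0"
    by (intro sum.neutral) blast
  then show "(P *v x) $ i = 0"
    by (simp add: matrix_vector_mult_def)
qed

lemma cmat_mult_supported_on:
  assumes "access_closed P I" "x \<in> supported_on I"
  shows "cmat P *v x \<in> supported_on I"
proof (rule supported_onI)
  fix i assume i: "i \<notin> I"
  have "complex_of_real (P $ i $ j) * x $ j = 0" for j
    using access_closed_zero[OF assms(1) i, of j] supported_onD[OF assms(2), of j] by (cases "j \<in> I") auto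
  then have "(\<Sum>j\<in>UNIV. complex_of_real (P $ i $ j) * x $ j) = 0"
    by (intro sum.neutral) blast
  then show "(cmat P *v x) $ i = 0"
    by (simp add: matrix_vector_mult_def cmat_def)
qed

text \<open>Choose an index \<open>j\<close> terminal in the support of \<open>z\<close>. Any
  support index reached from the class of \<open>j\<close> lies in that class, so on its rows the
  full matrix acts on \<open>z\<close> as the diagonal block does. The index returned with
  \<open>z $ i \<noteq> 0\<close> locates the class inside any closed set supporting
  \<open>z\<close>.\<close>

lemma eigenvalue_in_class_spectrum:
  assumes z: "z \<noteq> 0" and eig: "cmat P *v z = \<mu> *s z"
  obtains \<beta> i where "\<beta> \<in> classes P" "i \<in> \<beta>" "z $ i \<noteq> 0" "\<mu> \<in> sub_spectrum P \<beta>"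
proof -
  define X where "X = {i. z $ i \<noteq> 0}"
  obtain i where "i \<in> X" using z by (auto simp: vec_eq_iff X_def)
  then obtain j where "j \<in> X" "\<And>k. k \<in> X \<Longrightarrow> has_access P j k \<Longrightarrow> has_access P k j"
    using exists_final_index[of i X P] by blast
  then have j: "z $ j \<noteq> 0" "\<And>k. z $ k \<noteq> 0 \<Longrightarrow> has_access P j k \<Longrightarrow> has_access P k j"
    by (auto simp: X_def)
  have "(\<Sum>k\<in>class_of P j. complex_of_real (P $ i $ k) * z $ k) = \<mu> * z $ i" if i: "i \<in> class_of P j" for i
  proof -
    have "complex_of_real (P $ i $ k) * z $ k = 0" if "k \<notin> class_of P j" for k
    proof (rule ccontr)
      assume "\<not> ?thesis"
      then have "has_access P i k" "z $ k \<noteq> 0" by (auto intro: has_access_arc)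
      then have "has_access P j k" using i by (auto simp: class_of_def intro: has_access_trans)
      then show False using j(2) \<open>z $ k \<noteq> 0\<close> that by (auto simp: class_of_def)
    qed
    then have "(\<Sum>k\<in>class_of P j. complex_of_real (P $ i $ k) * z $ k)
        = (\<Sum>k\<in>UNIV. complex_of_real (P $ i $ k) * z $ k)"
      by (intro sum.mono_neutral_left) auto
    also have "\<dots> = (cmat P *v z) $ i"
      by (simp add: matrix_vector_mult_def cmat_def)
    finally show ?thesis by (simp add: eig)
  qed
  then have "\<mu> \<in> sub_spectrum P (class_of P j)"
    unfolding sub_spectrum_def using j(1) mem_class_of_self by blast
  then show ?thesis
    using that class_of_in_classes mem_class_of_self j(1) by metis
qed

section \<open>Monotone iteration of \<open>P + 1\<close>\<close>

lemma nonneg_mult_mono: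
  fixes P :: "real^'n^'n"
  assumes "\<forall>i j. 0 \<le> P $ i $ j" "\<And>i. x $ i \<le> y $ i"
  shows "(P *v x) $ i \<le> (P *v y) $ i"
  using assms by (simp add: matrix_vector_mult_def sum_mono mult_left_mono)

lemma nonneg_entry_le_mult:
  fixes P :: "real^'n^'n"
  assumes "\<forall>i j. 0 \<le> P $ i $ j" "\<And>i. 0 \<le> y $ i"
  shows "P $ i $ k * y $ k \<le> (P *v y) $ i"
  using assms member_le_sum[of k UNIV "\<lambda>k. P $ i $ k * y $ k"] by (simp add: matrix_vector_mult_def)

lemma funpow_Suc_add_mat_1:
  "((*v) (P + mat 1) ^^ Suc m) x $ i = (P *v ((*v) (P + mat 1) ^^ m) x) $ i + ((*v) (P + mat 1) ^^ m) x $ i"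
  for P :: "'a::semiring_1^'n^'n"
  unfolding funpow.simps o_apply by (subst matrix_vector_mult_add_rdistrib) simp

lemma funpow_add_mat_1_mono:
  fixes P :: "real^'n^'n"
  assumes P: "\<forall>i j. 0 \<le> P $ i $ j" and le: "\<And>i. x $ i \<le> y $ i"
  shows "((*v) (P + mat 1) ^^ m) x $ i \<le> ((*v) (P + mat 1) ^^ m) y $ i"
proof (induction m arbitrary: i)
  case (Suc m)
  have "(P *v ((*v) (P + mat 1) ^^ m) x) $ i \<le> (P *v ((*v) (P + mat 1) ^^ m) y) $ i"
    using P Suc by (rule nonneg_mult_mono)
  then show ?case
    using Suc[of i] unfolding funpow_Suc_add_mat_1 by (rule add_mono)
qed (use le in simp)

lemma funpow_mult_vec_0: "((*v) (M :: 'a::semiring_1^'n^'n) ^^ m) 0 = 0"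
  by (induction m) simp_all

lemma funpow_mult_vec_scaleR: "((*v) M ^^ m) (c *\<^sub>R x) = c *\<^sub>R ((*v) (M :: real^'n^'n) ^^ m) x"
  by (induction m) (simp_all add: matrix_vector_mult_scaleR)

lemma funpow_mult_vec_diff_real: "((*v) M ^^ m) (x - y) = ((*v) (M :: real^'n^'n) ^^ m) x - ((*v) M ^^ m) y"
  by (induction m) (simp_all add: matrix_vector_mult_diff_distrib)

lemma funpow_add_mat_1_nonneg:
  fixes P :: "real^'n^'n"
  assumes P: "\<forall>i j. 0 \<le> P $ i $ j" and "\<And>i. 0 \<le> x $ i"
  shows "0 \<le> ((*v) (P + mat 1) ^^ m) x $ i"
  using funpow_add_mat_1_mono[OF P, of 0 x m i] assms(2) by (simp add: funpow_mult_vec_0)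

lemma funpow_add_mat_1_ge:
  fixes P :: "real^'n^'n"
  assumes P: "\<forall>i j. 0 \<le> P $ i $ j" and r: "0 \<le> r"
    and u: "\<And>i. r * u $ i \<le> ((P + mat 1) *v u) $ i"
  shows "r ^ m * u $ i \<le> ((*v) (P + mat 1) ^^ m) u $ i"
proof (induction m arbitrary: i)
  case (Suc m)
  have "r ^ Suc m * u $ i = r ^ m * (r * u $ i)"
    by simp
  also have "\<dots> \<le> r ^ m * ((P + mat 1) *v u) $ i"
    using u r by (intro mult_left_mono) auto
  also have "\<dots> = ((P + mat 1) *v (r ^ m *\<^sub>R u)) $ i"
    by (simp add: matrix_vector_mult_scaleR)
  also have "\<dots> \<le> ((*v) (P + mat 1) ^^ Suc m) u $ i"
    using funpow_add_mat_1_mono[OF P, of "r ^ m *\<^sub>R u" "((*v) (P + mat 1) ^^ m) u" 1 i] Suc by simp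
  finally show ?case .
qed simp

text \<open>Each arc of the path, followed backwards, costs one more application of
  \<open>P + 1\<close>.\<close>

lemma funpow_add_mat_1_reaches:
  fixes P :: "real^'n^'n"
  assumes P: "\<forall>i j. 0 \<le> P $ i $ j" and u: "\<And>i. 0 \<le> u $ i"
    and ij: "has_access P i j" "0 < u $ j"
  shows "\<exists>m. 0 < ((*v) (P + mat 1) ^^ m) u $ i"
  using ij(1) unfolding has_access_def
proof (induction rule: converse_rtrancl_induct)
  case base
  show ?case using ij(2) by (intro exI[of _ 0]) simp
next
  case (step i k)
  then obtain m where m: "0 < ((*v) (P + mat 1) ^^ m) u $ k" by blast
  let ?y = "((*v) (P + mat 1) ^^ m) u"
  have nn: "0 \<le> ?y $ i" for i
    by (rule funpow_add_mat_1_nonneg[OF P u])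
  have "0 < P $ i $ k"
    using step P by (auto simp: arcs_def less_le)
  then have "0 < P $ i $ k * ?y $ k" using m by simp
  also have "\<dots> \<le> (P *v ?y) $ i"
    using P nn by (rule nonneg_entry_le_mult)
  also have "\<dots> \<le> ((*v) (P + mat 1) ^^ Suc m) u $ i"
    using nn[of i] unfolding funpow_Suc_add_mat_1 by simp
  finally show ?case by blast
qed

text \<open>Once the \<open>k\<close>-th iterate of \<open>u\<close> is positive at
  \<open>i\<close>, the inequality for \<open>u\<close> keeps the \<open>m\<close>-th iterate at
  least a positive multiple of \<open>r ^ m\<close> there, while the iterates of \<open>w\<close>
  are of smaller order. Finiteness of \<open>I\<close> yields a common \<open>m\<close>.\<close>

lemma dominated_perturbation_positive:
  fixes P :: "real^'n^'n"
  assumes P: "\<forall>i j. 0 \<le> P $ i $ j" and r: "0 < r"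
    and u: "\<And>i. 0 \<le> u $ i" "\<And>i. r * u $ i \<le> ((P + mat 1) *v u) $ i"
    and acc: "\<And>i. i \<in> I \<Longrightarrow> \<exists>j. has_access P i j \<and> 0 < u $ j"
    and w: "\<And>i. (\<lambda>m. ((*v) (P + mat 1) ^^ m) w $ i / r ^ m) \<longlonglongrightarrow> 0"
  shows "\<exists>m. \<forall>i\<in>I. 0 < ((*v) (P + mat 1) ^^ m) (u - w) $ i"
proof -
  let ?f = "(*v) (P + mat 1)"
  have "\<forall>\<^sub>F m in sequentially. 0 < (?f ^^ m) (u - w) $ i" if i: "i \<in> I" for i
  proof -
    obtain k where k: "0 < (?f ^^ k) u $ i"
      using acc[OF i] funpow_add_mat_1_reaches[OF P u(1)] by blast
    then have "\<forall>\<^sub>F m in sequentially. (?f ^^ m) w $ i / r ^ m < (?f ^^ k) u $ i / r ^ k"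
      using r by (intro order_tendstoD(2)[OF w]) simp
    then show ?thesis
      using eventually_ge_at_top[of k]
    proof eventually_elim
      case (elim m)
      have "r ^ (m - k) *\<^sub>R (?f ^^ k) u = (?f ^^ k) (r ^ (m - k) *\<^sub>R u)"
        by (simp add: funpow_mult_vec_scaleR)
      then have "r ^ (m - k) * (?f ^^ k) u $ i = (?f ^^ k) (r ^ (m - k) *\<^sub>R u) $ i"
        by (metis vector_scaleR_component real_scaleR_def)
      also have "\<dots> \<le> (?f ^^ k) ((?f ^^ (m - k)) u) $ i"
        using r funpow_add_mat_1_ge[OF P _ u(2), of "m - k"]
        by (intro funpow_add_mat_1_mono[OF P]) simp
      also have "(?f ^^ k) ((?f ^^ (m - k)) u) = (?f ^^ m) u"
        using elim(2) by (simp flip: funpow_add comp_apply[of "?f ^^ k"])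
      finally have ge: "r ^ (m - k) * (?f ^^ k) u $ i \<le> (?f ^^ m) u $ i" .
      have "(?f ^^ m) w $ i < r ^ m * ((?f ^^ k) u $ i / r ^ k)"
        using elim(1) r by (simp add: field_simps)
      also have "\<dots> = r ^ (m - k) * (?f ^^ k) u $ i"
        using elim(2) r by (simp add: power_diff)
      finally show ?case
        using ge by (simp add: funpow_mult_vec_diff_real)
    qed
  qed
  then have "\<forall>\<^sub>F m in sequentially. \<forall>i\<in>I. 0 < (?f ^^ m) (u - w) $ i"
    by (intro eventually_ball_finite) auto
  then show ?thesis
    by (auto simp: eventually_sequentially)
qed

text \<open>The purpose of the shift by the identity: other points of the circle of radius
  \<open>lam\<close> move strictly inside the circle of radius \<open>lam + 1\<close>, because their
  real part is less than \<open>lam\<close>.\<close>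

lemma cmod_add_1_less:
  assumes "cmod z \<le> lam" "z \<noteq> of_real lam"
  shows "cmod (z + 1) < lam + 1"
proof -
  have lam: "0 \<le> lam" using assms(1) norm_ge_zero order_trans by blast
  have sq: "(Re z)\<^sup>2 + (Im z)\<^sup>2 \<le> lam\<^sup>2"
    using assms(1) by (simp add: cmod_power2[symmetric] power_mono)
  have "Re z < lam"
  proof (rule ccontr)
    assume "\<not> Re z < lam"
    then have "Re z = lam"
      using complex_Re_le_cmod[of z] assms(1) by linarith
    then show False using sq assms(2) by (auto simp: complex_eq_iff)
  qed
  then have "(cmod (z + 1))\<^sup>2 < (lam + 1)\<^sup>2"
    using sq unfolding cmod_power2 by (simp add: power2_eq_square algebra_simps)
  then show ?thesis
    using lam by (simp add: power_less_imp_less_base)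
qed

section \<open>Existence of positive generalized eigenvectors\<close>

text \<open>An eigenvalue of \<open>P\<close> on \<open>W\<close> belongs to the block of a class
  inside \<open>I\<close>, so its modulus is at most \<open>lam\<close>, and it differs from
  \<open>lam\<close> by \<open>no_eigen\<close>. After the shift the decay criterion applies with
  radius \<open>lam + 1\<close>.\<close>

lemma iterates_decay_real:
  fixes P :: "real^'n^'n" and W :: "(complex^'n) set"
  assumes P: "\<forall>i j. 0 \<le> P $ i $ j" and I: "access_closed P I"
    and bound: "\<And>\<beta>. \<beta> \<in> classes P \<Longrightarrow> \<beta> \<subseteq> I \<Longrightarrow> sub_spectral_radius P \<beta> \<le> lam"
    and W: "\<And>x y. x \<in> W \<Longrightarrow> y \<in> W \<Longrightarrow> x - y \<in> W" "\<And>c x. x \<in> W \<Longrightarrow> c *s x \<in> W"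
      "\<And>x. x \<in> W \<Longrightarrow> cmat P *v x \<in> W" "W \<subseteq> supported_on I"
    and no_eigen: "\<And>z. z \<in> W \<Longrightarrow> cmat P *v z = complex_of_real lam *s z \<Longrightarrow> z = 0"
    and z: "z \<in> W"
  shows "(\<lambda>m. ((*v) (P + mat 1) ^^ m) (rvec z) $ i / (lam + 1) ^ m) \<longlonglongrightarrow> 0"
proof -
  have "(\<lambda>m. ((*v) (cmat (P + mat 1)) ^^ m) z $ i / of_real (lam + 1) ^ m) \<longlonglongrightarrow> 0"
  proof (rule power_iterates_decay[where W = W])
    have add: "x + y \<in> W" if "x \<in> W" "y \<in> W" for x y
      using W(1)[OF that(1) W(2)[OF that(2), of "-1"]] by simp
    show "cmat (P + mat 1) *v x \<in> W" if "x \<in> W" for x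
      using that add W(3) by (simp add: cmat_add_mat_1_mult)
    show "cmod \<mu> < lam + 1" if y: "y \<in> W" "y \<noteq> 0" "cmat (P + mat 1) *v y = \<mu> *s y" for \<mu> y
    proof -
      have eig: "cmat P *v y = (\<mu> - 1) *s y"
        using y(3) by (simp add: cmat_add_mat_1_mult algebra_simps vec.scale_left_diff_distrib)
      obtain \<beta> i where \<beta>: "\<beta> \<in> classes P" "i \<in> \<beta>" "y $ i \<noteq> 0" "\<mu> - 1 \<in> sub_spectrum P \<beta>"
        using eigenvalue_in_class_spectrum[OF y(2) eig] .
      have "i \<in> I" using \<beta>(3) y(1) W(4) supported_onD by blast
      then have "\<beta> \<subseteq> I" using class_subset_closed[OF I \<beta>(1,2)] by blast
      moreover have "cmod (\<mu> - 1) \<le> sub_spectral_radius P \<beta>"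
        using class_perron[OF P \<beta>(1)] \<beta>(4) by blast
      ultimately have "cmod (\<mu> - 1) \<le> lam" using bound[OF \<beta>(1)] by linarith
      moreover have "\<mu> - 1 \<noteq> of_real lam" using no_eigen[OF y(1)] eig y(2) by metis
      ultimately show ?thesis using cmod_add_1_less[of "\<mu> - 1" lam] by simp
    qed
  qed (use W z in auto)
  then have "(\<lambda>m. Re (((*v) (cmat (P + mat 1)) ^^ m) z $ i / of_real (lam + 1) ^ m)) \<longlonglongrightarrow> Re 0"
    by (rule tendsto_Re)
  moreover have "Re (((*v) (cmat (P + mat 1)) ^^ m) z $ i / of_real (lam + 1) ^ m)
      = ((*v) (P + mat 1) ^^ m) (rvec z) $ i / (lam + 1) ^ m" for m
  proof -
    have "((*v) (P + mat 1) ^^ m) (rvec z) $ i = Re (((*v) (cmat (P + mat 1)) ^^ m) z $ i)"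
      unfolding funpow_rvec_cmat[symmetric] by (simp add: rvec_def)
    then show ?thesis
      by (simp only: Re_divide_of_real of_real_power[symmetric])
  qed
  ultimately show ?thesis by (simp only: zero_complex.sel)
qed

lemma funpow_commute:
  assumes "\<And>x. f (g x) = g (f x)"
  shows "(f ^^ k) ((g ^^ m) x) = (g ^^ m) ((f ^^ k) x)"
proof -
  have "f ((g ^^ m) x) = (g ^^ m) (f x)" for x
    by (induction m) (simp_all add: assms)
  then show ?thesis by (induction k) simp_all
qed

text \<open>The common end of both existence proofs: \<open>W\<close> is the invariant subspace
  without eigenvalue \<open>lam\<close>, and \<open>u - rvec z\<close> is the kernel component of
  \<open>u\<close>. Iterating \<open>P + 1\<close> makes that component positive on \<open>I\<close>
  and keeps it in the kernel, since \<open>P + 1\<close> commutes with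
  \<open>lam - P\<close>.\<close>

lemma positive_kernel_vector:
  fixes P :: "real^'n^'n" and W :: "(complex^'n) set"
  assumes P: "\<forall>i j. 0 \<le> P $ i $ j" and I: "access_closed P I" and lam: "0 \<le> lam"
    and bound: "\<And>\<beta>. \<beta> \<in> classes P \<Longrightarrow> \<beta> \<subseteq> I \<Longrightarrow> sub_spectral_radius P \<beta> \<le> lam"
    and u: "\<And>i. 0 \<le> u $ i" "u \<in> supported_on I" "\<And>i. lam * u $ i \<le> (P *v u) $ i"
      "\<And>i. i \<in> I \<Longrightarrow> \<exists>j. has_access P i j \<and> 0 < u $ j"
    and W: "\<And>x y. x \<in> W \<Longrightarrow> y \<in> W \<Longrightarrow> x - y \<in> W" "\<And>c x. x \<in> W \<Longrightarrow> c *s x \<in> W"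
      "\<And>x. x \<in> W \<Longrightarrow> cmat P *v x \<in> W" "W \<subseteq> supported_on I"
    and no_eigen: "\<And>z. z \<in> W \<Longrightarrow> cmat P *v z = complex_of_real lam *s z \<Longrightarrow> z = 0"
    and z: "z \<in> W" "((*v) (lam *\<^sub>R mat 1 - P) ^^ k) (u - rvec z) = 0"
  shows "\<exists>y. (\<forall>i\<in>I. 0 < y $ i) \<and> y \<in> supported_on I \<and> ((*v) (lam *\<^sub>R mat 1 - P) ^^ k) y = 0"
proof -
  have "\<exists>m. \<forall>i\<in>I. 0 < ((*v) (P + mat 1) ^^ m) (u - rvec z) $ i"
  proof (rule dominated_perturbation_positive[OF P])
    show "0 < lam + 1" using lam by simp
    show "(lam + 1) * u $ i \<le> ((P + mat 1) *v u) $ i" for i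
      using u(3)[of i] by (simp add: matrix_vector_mult_add_rdistrib algebra_simps)
    show "(\<lambda>m. ((*v) (P + mat 1) ^^ m) (rvec z) $ i / (lam + 1) ^ m) \<longlonglongrightarrow> 0" for i
      by (rule iterates_decay_real[OF P I bound W no_eigen z(1)])
  qed (use u in auto)
  then obtain m where m: "\<forall>i\<in>I. 0 < ((*v) (P + mat 1) ^^ m) (u - rvec z) $ i" by blast
  have "u - rvec z \<in> supported_on I"
    using W(4) z(1) u(2) by (auto intro: supported_on_diff rvec_supported_on)
  then have "((*v) (P + mat 1) ^^ m) (u - rvec z) \<in> supported_on I"
  proof (induction m)
    case (Suc m)
    then have IH: "((*v) (P + mat 1) ^^ m) (u - rvec z) \<in> supported_on I" by blast
    show ?case
    proof (rule supported_onI)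
      fix i assume "i \<notin> I"
      then show "((*v) (P + mat 1) ^^ Suc m) (u - rvec z) $ i = 0"
        unfolding funpow_Suc_add_mat_1
        using supported_onD[OF mult_supported_on[OF I IH]] supported_onD[OF IH] by simp
    qed
  qed simp
  moreover have "(lam *\<^sub>R mat 1 - P) *v ((P + mat 1) *v x) = (P + mat 1) *v ((lam *\<^sub>R mat 1 - P) *v x)" for x
    by (simp add: shift_mult matrix_vector_mult_add_rdistrib matrix_vector_right_distrib
        matrix_vector_mult_diff_distrib matrix_vector_mult_scaleR scaleR_right_distrib)
  then have "((*v) (lam *\<^sub>R mat 1 - P) ^^ k) (((*v) (P + mat 1) ^^ m) (u - rvec z)) = 0"
    using funpow_commute[of "(*v) (lam *\<^sub>R mat 1 - P)" "(*v) (P + mat 1)" k m] z(2)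
    by (simp add: funpow_mult_vec_0)
  ultimately show ?thesis using m by blast
qed

section \<open>Positive vectors built from the final classes\<close>

lemma class_block_mult:
  fixes P :: "'a::semiring_1^'n^'n"
  assumes "\<And>j. j \<notin> \<beta> \<Longrightarrow> P $ i $ j * x $ j = 0"
  shows "(P *v x) $ i = (\<Sum>j\<in>\<beta>. P $ i $ j * x $ j)"
  unfolding matrix_vector_mult_def using assms
  by (simp, intro sum.mono_neutral_right) auto

text \<open>Arcs from a final class into \<open>I\<close> stay in the class, so on its rows
  \<open>P\<close> acts as its diagonal block.\<close>

lemma final_class_block_mult:
  fixes P :: "real^'n^'n"
  assumes I: "access_closed P I" and fin: "final_in P (initial_collection P I) \<alpha>"
    and x: "x \<in> supported_on I" and i: "i \<in> \<alpha>"
  shows "(P *v x) $ i = (\<Sum>j\<in>\<alpha>. P $ i $ j * x $ j)"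
proof (rule class_block_mult)
  fix j assume j: "j \<notin> \<alpha>"
  show "P $ i $ j * x $ j = 0"
  proof (cases "j \<in> I")
    case True
    then have "\<not> has_access P i j"
      using fin i j unfolding final_in_closed_iff[OF I] by blast
    then have "P $ i $ j = 0" using has_access_arc by blast
    then show ?thesis by simp
  qed (use x in \<open>simp add: supported_onD\<close>)
qed

lemma final_classes_vector:
  fixes P :: "real^'n^'n"
  assumes P: "\<forall>i j. 0 \<le> P $ i $ j" and I: "access_closed P I"
    and fin: "\<forall>\<alpha>. final_in P (initial_collection P I) \<alpha> \<longrightarrow> sub_spectral_radius P \<alpha> = lam"
  obtains u where "\<forall>i. 0 \<le> u $ i" "u \<in> supported_on I"
    "\<forall>\<alpha> i. final_in P (initial_collection P I) \<alpha> \<longrightarrow> i \<in> \<alpha> \<longrightarrow> 0 < u $ i \<and> (P *v u) $ i = lam * u $ i"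
    "\<forall>i. (\<forall>\<alpha>. final_in P (initial_collection P I) \<alpha> \<longrightarrow> i \<notin> \<alpha>) \<longrightarrow> u $ i = 0"
proof -
  have "\<forall>\<beta>. \<exists>v. \<beta> \<in> classes P \<longrightarrow> (\<forall>i\<in>\<beta>. 0 < v $ i) \<and>
      (\<forall>i\<in>\<beta>. (\<Sum>j\<in>\<beta>. P $ i $ j * v $ j) = sub_spectral_radius P \<beta> * v $ i)"
    using class_perron[OF P] by metis
  then obtain V where V: "\<And>\<beta> i. \<beta> \<in> classes P \<Longrightarrow> i \<in> \<beta> \<Longrightarrow> 0 < V \<beta> $ i"
    "\<And>\<beta> i. \<beta> \<in> classes P \<Longrightarrow> i \<in> \<beta> \<Longrightarrow>
      (\<Sum>j\<in>\<beta>. P $ i $ j * V \<beta> $ j) = sub_spectral_radius P \<beta> * V \<beta> $ i"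
    by metis
  \<comment> \<open>Classes are disjoint, so the sum of the Perron vectors is read off
    coordinatewise from the class of each index.\<close>
  define u where "u = (\<chi> i. if final_in P (initial_collection P I) (class_of P i) then V (class_of P i) $ i else 0)"
  have fin_cl: "\<alpha> \<in> classes P" "\<alpha> \<subseteq> I" if "final_in P (initial_collection P I) \<alpha>" for \<alpha>
    using that unfolding final_in_closed_iff[OF I] by auto
  have u_eq: "u $ i = V \<alpha> $ i" if "final_in P (initial_collection P I) \<alpha>" "i \<in> \<alpha>" for \<alpha> i
    using that class_of_eqI[OF fin_cl(1)[OF that(1)] that(2)] by (simp add: u_def)
  have u_0: "u $ i = 0" if "\<forall>\<alpha>. final_in P (initial_collection P I) \<alpha> \<longrightarrow> i \<notin> \<alpha>" for i
    using that by (auto simp: u_def)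
  have supp: "u \<in> supported_on I"
    using u_0 fin_cl(2) by (intro supported_onI) blast
  have "0 \<le> u $ i" for i
    using V(1)[of "class_of P i" i] by (simp add: u_def less_imp_le)
  moreover have "0 < u $ i \<and> (P *v u) $ i = lam * u $ i"
    if f: "final_in P (initial_collection P I) \<alpha>" and i: "i \<in> \<alpha>" for \<alpha> i
  proof
    show "0 < u $ i" using V(1)[OF fin_cl(1)[OF f] i] u_eq[OF f i] by simp
    have "(P *v u) $ i = (\<Sum>j\<in>\<alpha>. P $ i $ j * V \<alpha> $ j)"
      unfolding final_class_block_mult[OF I f supp i] by (simp add: u_eq[OF f])
    then show "(P *v u) $ i = lam * u $ i"
      using V(2)[OF fin_cl(1)[OF f] i] fin f u_eq[OF f i] by simp
  qed
  ultimately show ?thesis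
    using that supp u_0 by blast
qed

lemma linear_mult_vec: "linear ((*v) M)" for M :: "complex^'n^'m"
  by (rule linearI) (simp_all add: matrix_vector_right_distrib flip: of_real_scale_vec add: vector_scalar_commute)

text \<open>Fitting's splitting for \<open>lam - P\<close> on the complex vectors supported on
  \<open>I\<close>; \<open>W\<close> is the stable image, on which \<open>lam - P\<close> is
  injective.\<close>

lemma positive_generalized_eigenvector_exists:
  fixes P :: "real^'n^'n"
  assumes P: "\<forall>i j. 0 \<le> P $ i $ j" and I: "access_closed P I" and lam: "0 \<le> lam"
    and bound: "\<And>\<beta>. \<beta> \<in> classes P \<Longrightarrow> \<beta> \<subseteq> I \<Longrightarrow> sub_spectral_radius P \<beta> \<le> lam"
    and fin: "\<forall>\<alpha>. final_in P (initial_collection P I) \<alpha> \<longrightarrow> sub_spectral_radius P \<alpha> = lam"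
  shows "\<exists>y k. (\<forall>i\<in>I. 0 < y $ i) \<and> y \<in> supported_on I \<and> ((*v) (lam *\<^sub>R mat 1 - P) ^^ k) y = 0"
proof -
  obtain u where "\<forall>i. 0 \<le> u $ i" "u \<in> supported_on I"
    "\<forall>\<alpha> i. final_in P (initial_collection P I) \<alpha> \<longrightarrow> i \<in> \<alpha> \<longrightarrow> 0 < u $ i \<and> (P *v u) $ i = lam * u $ i"
    "\<forall>i. (\<forall>\<alpha>. final_in P (initial_collection P I) \<alpha> \<longrightarrow> i \<notin> \<alpha>) \<longrightarrow> u $ i = 0"
    using final_classes_vector[OF P I fin] .
  note u = this[rule_format]
  let ?T = "(*v) (cmat (lam *\<^sub>R mat 1 - P))"
  let ?V = "supported_on I :: (complex^'n) set"
  have inv: "?T ` ?V \<subseteq> ?V"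
    using cmat_mult_supported_on[OF I] by (auto simp: cmat_shift_mult intro!: supported_on_diff supported_on_scale)
  obtain k where k: "\<And>z. z \<in> ?V \<Longrightarrow> ?T ((?T ^^ k) z) = 0 \<Longrightarrow> (?T ^^ k) z = 0"
    "\<And>w. w \<in> ?V \<Longrightarrow> \<exists>y\<in>?V. (?T ^^ k) (w - (?T ^^ k) y) = 0"
    using fitting_decomposition[OF linear_mult_vec subspace_supported_on inv] by blast
  obtain y where y: "y \<in> ?V" "(?T ^^ k) (cvec u - (?T ^^ k) y) = 0"
    using k(2)[OF cvec_supported_on[OF u(2)]] by blast
  have "\<exists>y. (\<forall>i\<in>I. 0 < y $ i) \<and> y \<in> supported_on I \<and> ((*v) (lam *\<^sub>R mat 1 - P) ^^ k) y = 0"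
  proof (rule positive_kernel_vector[OF P I lam bound u(1,2), where W = "(?T ^^ k) ` ?V" and z = "(?T ^^ k) y"])
    \<comment> \<open>Equality holds on final classes; elsewhere \<open>u\<close> vanishes and the
      right side is nonnegative.\<close>
    show "lam * u $ i \<le> (P *v u) $ i" for i
    proof (cases "\<exists>\<alpha>. final_in P (initial_collection P I) \<alpha> \<and> i \<in> \<alpha>")
      case True
      then show ?thesis using u(3) by force
    next
      case False
      then have "u $ i = 0" using u(4) by blast
      then show ?thesis using P u(1) by (simp add: matrix_vector_mult_def sum_nonneg)
    qed
    show "\<exists>j. has_access P i j \<and> 0 < u $ j" if "i \<in> I" for i
      using exists_final_class[OF I that] u(3) by metis
    show "a - b \<in> (?T ^^ k) ` ?V" if "a \<in> (?T ^^ k) ` ?V" "b \<in> (?T ^^ k) ` ?V" for a b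
      using that by (auto simp flip: funpow_mult_vec_diff intro!: imageI supported_on_diff)
    show "c *s a \<in> (?T ^^ k) ` ?V" if "a \<in> (?T ^^ k) ` ?V" for a c
      using that by (auto simp flip: funpow_mult_vec_scale intro!: imageI supported_on_scale)
    show "cmat P *v a \<in> (?T ^^ k) ` ?V" if a: "a \<in> (?T ^^ k) ` ?V" for a
    proof -
      obtain b where b: "b \<in> ?V" "a = (?T ^^ k) b" using a by blast
      have "?T (cmat P *v x) = cmat P *v (?T x)" for x
        by (simp add: cmat_shift_mult matrix_vector_mult_diff_distrib vector_scalar_commute)
      then have "cmat P *v a = (?T ^^ k) (cmat P *v b)"
        using funpow_commute[of ?T "(*v) (cmat P)" k 1 b] b by simp
      then show ?thesis using cmat_mult_supported_on[OF I b(1)] by blast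
    qed
    have pow: "(?T ^^ j) x \<in> ?V" if "x \<in> ?V" for j x
      using that inv by (induction j) auto
    then show "(?T ^^ k) ` ?V \<subseteq> ?V" by blast
    show "a = 0" if "a \<in> (?T ^^ k) ` ?V" "cmat P *v a = complex_of_real lam *s a" for a
      using that k(1) by (auto simp: cmat_shift_mult)
    show "(?T ^^ k) y \<in> (?T ^^ k) ` ?V" using y by blast
    have "((*v) (lam *\<^sub>R mat 1 - P) ^^ k) (rvec (cvec u - (?T ^^ k) y)) = rvec 0"
      unfolding funpow_rvec_cmat[symmetric] y(2) ..
    then show "((*v) (lam *\<^sub>R mat 1 - P) ^^ k) (u - rvec ((?T ^^ k) y)) = 0"
      by (simp add: rvec_diff) (simp add: rvec_def vec_eq_iff)
  qed
  then show ?thesis by blast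
qed

text \<open>On the part \<open>A\<close> of \<open>I\<close> outside the final classes,
  \<open>lam - P\<close> is invertible. As \<open>u\<close> already solves the eigenvector equation
  on the final classes, its defect lies over \<open>A\<close> and is removed by subtracting a vector
  \<open>w\<close> supported there.\<close>

lemma positive_eigenvector_exists:
  fixes P :: "real^'n^'n"
  assumes P: "\<forall>i j. 0 \<le> P $ i $ j" and I: "access_closed P I" and lam: "0 \<le> lam"
    and bound: "\<And>\<beta>. \<beta> \<in> classes P \<Longrightarrow> \<beta> \<subseteq> I \<Longrightarrow> \<not> final_in P (initial_collection P I) \<beta> \<Longrightarrow>
      sub_spectral_radius P \<beta> < lam"
    and fin: "\<forall>\<alpha>. final_in P (initial_collection P I) \<alpha> \<longrightarrow> sub_spectral_radius P \<alpha> = lam"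
  shows "\<exists>y. (\<forall>i\<in>I. 0 < y $ i) \<and> y \<in> supported_on I \<and> P *v y = lam *\<^sub>R y"
proof -
  obtain u where "\<forall>i. 0 \<le> u $ i" "u \<in> supported_on I"
    "\<forall>\<alpha> i. final_in P (initial_collection P I) \<alpha> \<longrightarrow> i \<in> \<alpha> \<longrightarrow> 0 < u $ i \<and> (P *v u) $ i = lam * u $ i"
    "\<forall>i. (\<forall>\<alpha>. final_in P (initial_collection P I) \<alpha> \<longrightarrow> i \<notin> \<alpha>) \<longrightarrow> u $ i = 0"
    using final_classes_vector[OF P I fin] .
  note u = this[rule_format]
  define A where "A = {i \<in> I. \<forall>\<alpha>. final_in P (initial_collection P I) \<alpha> \<longrightarrow> i \<notin> \<alpha>}"
  \<comment> \<open>An index of a final class with access to some \<open>j\<close> in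
    \<open>I\<close> would force \<open>j\<close> into that class, so only non-final indices have
    access to \<open>A\<close>.\<close>
  have A: "access_closed P A"
    unfolding access_closed_def
  proof (intro allI impI)
    fix i j assume ij: "has_access P i j" "j \<in> A"
    then have jI: "j \<in> I" by (simp add: A_def)
    then have "i \<in> I" using ij access_closedD[OF I] by blast
    moreover have "i \<notin> \<alpha>" if "final_in P (initial_collection P I) \<alpha>" for \<alpha>
      using that ij jI unfolding A_def final_in_closed_iff[OF I] by blast
    ultimately show "i \<in> A" by (simp add: A_def)
  qed
  \<comment> \<open>An eigenvector would place \<open>lam\<close> in the spectrum of a non-final
    class, whose spectral radius is below \<open>lam\<close>.\<close>
  have no_eigen: "z = 0" if z: "z \<in> supported_on A" "cmat P *v z = complex_of_real lam *s z" for z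
  proof (rule ccontr)
    assume "z \<noteq> 0"
    then obtain \<beta> i where \<beta>: "\<beta> \<in> classes P" "i \<in> \<beta>" "z $ i \<noteq> 0" "complex_of_real lam \<in> sub_spectrum P \<beta>"
      using eigenvalue_in_class_spectrum z(2) by blast
    have "i \<in> A" using \<beta>(3) z(1) supported_onD by blast
    then have "\<beta> \<subseteq> I" "\<not> final_in P (initial_collection P I) \<beta>"
      using class_subset_closed[OF I \<beta>(1,2)] \<beta>(2) by (auto simp: A_def)
    moreover have "cmod (complex_of_real lam) \<le> sub_spectral_radius P \<beta>"
      using class_perron[OF P \<beta>(1)] \<beta>(4) by blast
    ultimately show False using bound[OF \<beta>(1)] lam by fastforce
  qed
  let ?T = "(*v) (lam *\<^sub>R mat 1 - P)"
  let ?V = "supported_on A :: (real^'n) set"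
  have inv: "?T ` ?V \<subseteq> ?V"
    using mult_supported_on[OF A] by (auto simp: shift_mult intro!: supported_on_diff supported_on_scaleR)
  have "inj_on ?T ?V"
    unfolding linear_inj_on_iff_eq_0[OF matrix_vector_mul_linear subspace_supported_on]
  proof (intro ballI impI)
    fix x assume x: "x \<in> ?V" "?T x = 0"
    then have "P *v x = lam *\<^sub>R x" by (simp add: shift_mult)
    then have "cmat P *v cvec x = complex_of_real lam *s cvec x"
      unfolding cmat_cvec by (simp add: vec_eq_iff cvec_def)
    then show "x = 0" using no_eigen[OF cvec_supported_on[OF x(1)]] by simp
  qed
  moreover have "span ?V = ?V" using subspace_supported_on span_eq_iff by blast
  ultimately have "dim (?T ` ?V) = dim ?V"
    by (intro dim_image_eq matrix_vector_mul_linear) (simp only:)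
  \<comment> \<open>An injective linear endomorphism of a finite-dimensional space is onto.\<close>
  then have onto: "?T ` ?V = ?V"
    by (intro subspace_dim_equal linear_subspace_image matrix_vector_mul_linear subspace_supported_on inv) simp
  have "?T u \<in> ?V"
  proof (rule supported_onI)
    fix i assume i: "i \<notin> A"
    show "?T u $ i = 0"
    proof (cases "i \<in> I")
      case True
      then obtain \<alpha> where "final_in P (initial_collection P I) \<alpha>" "i \<in> \<alpha>" using i by (auto simp: A_def)
      then show ?thesis using u(3) by (simp add: shift_mult)
    next
      case False
      then show ?thesis
        using u(2) mult_supported_on[OF I u(2)] by (simp add: shift_mult supported_onD)
    qed
  qed
  then obtain w where w: "w \<in> ?V" "?T w = ?T u" using onto by force
  have "\<exists>y. (\<forall>i\<in>I. 0 < y $ i) \<and> y \<in> supported_on I \<and> (?T ^^ 1) y = 0"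
  proof (rule positive_kernel_vector[OF P I lam _ u(1,2), where W = "supported_on A" and z = "cvec w"])
    show "sub_spectral_radius P \<beta> \<le> lam" if "\<beta> \<in> classes P" "\<beta> \<subseteq> I" for \<beta>
      using bound[OF that] fin by fastforce
    show "lam * u $ i \<le> (P *v u) $ i" for i
    proof (cases "\<exists>\<alpha>. final_in P (initial_collection P I) \<alpha> \<and> i \<in> \<alpha>")
      case True
      then show ?thesis using u(3) by force
    next
      case False
      then have "u $ i = 0" using u(4) by blast
      then show ?thesis using P u(1) by (simp add: matrix_vector_mult_def sum_nonneg)
    qed
    show "\<exists>j. has_access P i j \<and> 0 < u $ j" if "i \<in> I" for i
      using exists_final_class[OF I that] u(3) by metis
    show "supported_on A \<subseteq> (supported_on I :: (complex^'n) set)"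
      by (auto simp: supported_on_def A_def)
    show "(?T ^^ 1) (u - rvec (cvec w)) = 0"
      using w(2) by (simp add: matrix_vector_mult_diff_distrib)
  qed (use w no_eigen cmat_mult_supported_on[OF A] in
      \<open>auto intro: supported_on_diff supported_on_scale cvec_supported_on\<close>)
  then show ?thesis by (auto simp: shift_mult)
qed

section \<open>Necessary conditions and the main theorem\<close>

definition class_pairing :: "'n set \<Rightarrow> real^'n \<Rightarrow> real^'n \<Rightarrow> real" where
  "class_pairing \<beta> v x = (\<Sum>i\<in>\<beta>. v $ i * x $ i)"

lemma class_pairing_pos:
  assumes "\<beta> \<in> classes P" "\<And>i. i \<in> \<beta> \<Longrightarrow> 0 < v $ i" "\<And>i. i \<in> \<beta> \<Longrightarrow> 0 < x $ i"
  shows "0 < class_pairing \<beta> v x"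
  unfolding class_pairing_def using class_nonempty[OF assms(1)] assms(2,3) by (intro sum_pos) auto

lemma class_pairing_block:
  fixes P :: "real^'n^'n"
  assumes "\<And>j. j \<in> \<beta> \<Longrightarrow> (\<Sum>i\<in>\<beta>. v $ i * P $ i $ j) = r * v $ j"
  shows "(\<Sum>i\<in>\<beta>. v $ i * (\<Sum>j\<in>\<beta>. P $ i $ j * y $ j)) = r * class_pairing \<beta> v y"
proof -
  have "(\<Sum>i\<in>\<beta>. v $ i * (\<Sum>j\<in>\<beta>. P $ i $ j * y $ j)) = (\<Sum>j\<in>\<beta>. (\<Sum>i\<in>\<beta>. v $ i * P $ i $ j) * y $ j)"
    unfolding sum_distrib_left sum_distrib_right by (subst sum.swap) (simp add: mult.assoc)
  also have "\<dots> = (\<Sum>j\<in>\<beta>. r * (v $ j * y $ j))"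
    by (rule sum.cong) (simp_all add: assms mult.assoc)
  finally show ?thesis by (simp add: class_pairing_def sum_distrib_left)
qed

text \<open>On a final class each application of \<open>lam - P\<close> multiplies the pairing by
  \<open>lam - ?r\<close>. After \<open>k\<close> applications it is zero although it began
  positive, so the factor vanishes.\<close>

lemma final_class_spectral_radius:
  fixes P :: "real^'n^'n"
  assumes P: "\<forall>i j. 0 \<le> P $ i $ j" and I: "access_closed P I"
    and x: "\<And>i. i \<in> I \<Longrightarrow> 0 < x $ i" "x \<in> supported_on I"
      "((*v) (lam *\<^sub>R mat 1 - P) ^^ k) x = 0"
    and fin: "final_in P (initial_collection P I) \<alpha>"
  shows "sub_spectral_radius P \<alpha> = lam"
proof -
  let ?T = "(*v) (lam *\<^sub>R mat 1 - P)" and ?r = "sub_spectral_radius P \<alpha>"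
  have \<alpha>: "\<alpha> \<in> classes P" "\<alpha> \<subseteq> I"
    using fin unfolding final_in_closed_iff[OF I] by auto
  obtain v where v: "\<And>j. j \<in> \<alpha> \<Longrightarrow> 0 < v $ j"
    "\<And>j. j \<in> \<alpha> \<Longrightarrow> (\<Sum>i\<in>\<alpha>. v $ i * P $ i $ j) = ?r * v $ j"
    using class_perron[OF P \<alpha>(1)] by metis
  have step: "class_pairing \<alpha> v (?T y) = (lam - ?r) * class_pairing \<alpha> v y" if y: "y \<in> supported_on I" for y
  proof -
    have "class_pairing \<alpha> v (P *v y) = (\<Sum>i\<in>\<alpha>. v $ i * (\<Sum>j\<in>\<alpha>. P $ i $ j * y $ j))"
      by (simp add: class_pairing_def final_class_block_mult[OF I fin y])
    also have "\<dots> = ?r * class_pairing \<alpha> v y"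
      by (rule class_pairing_block) (rule v(2))
    finally have "class_pairing \<alpha> v (P *v y) = ?r * class_pairing \<alpha> v y" .
    then show ?thesis
      by (simp add: class_pairing_def shift_mult right_diff_distrib left_diff_distrib sum_subtractf
          sum_distrib_left mult.left_commute)
  qed
  have "(?T ^^ m) x \<in> supported_on I \<and> class_pairing \<alpha> v ((?T ^^ m) x) = (lam - ?r) ^ m * class_pairing \<alpha> v x" for m
  proof (induction m)
    case (Suc m)
    then have "(?T ^^ m) x \<in> supported_on I" by blast
    then have "?T ((?T ^^ m) x) \<in> supported_on I"
      by (simp add: shift_mult supported_on_diff supported_on_scaleR mult_supported_on[OF I])
    then show ?case using Suc step by simp
  qed (simp add: x)
  from this[of k] have "(lam - ?r) ^ k * class_pairing \<alpha> v x = 0"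
    using x(3) by (simp add: class_pairing_def)
  moreover have "0 < class_pairing \<alpha> v x"
    using \<alpha> x(1) v(1) by (intro class_pairing_pos) auto
  ultimately show ?thesis by simp
qed

text \<open>Restricting the row sums to the block drops only nonnegative terms.\<close>

lemma class_pairing_mult_ge:
  fixes P :: "real^'n^'n"
  assumes P: "\<forall>i j. 0 \<le> P $ i $ j"
    and v: "\<And>j. j \<in> \<beta> \<Longrightarrow> 0 < v $ j" "\<And>j. j \<in> \<beta> \<Longrightarrow> (\<Sum>i\<in>\<beta>. v $ i * P $ i $ j) = r * v $ j"
    and y: "\<And>i. 0 \<le> y $ i"
  shows "r * class_pairing \<beta> v y \<le> class_pairing \<beta> v (P *v y)"
proof -
  have "r * class_pairing \<beta> v y = (\<Sum>i\<in>\<beta>. v $ i * (\<Sum>j\<in>\<beta>. P $ i $ j * y $ j))"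
    by (rule class_pairing_block[symmetric]) (rule v(2))
  also have "\<dots> \<le> class_pairing \<beta> v (P *v y)"
    unfolding class_pairing_def
  proof (intro sum_mono mult_left_mono)
    fix i assume "i \<in> \<beta>"
    show "(\<Sum>j\<in>\<beta>. P $ i $ j * y $ j) \<le> (P *v y) $ i"
      unfolding matrix_vector_mult_def using P y by (simp add: sum_mono2)
  qed (use v in \<open>simp add: less_imp_le\<close>)
  finally show ?thesis .
qed

text \<open>If the radius \<open>?r\<close> exceeded \<open>lam\<close>, then
  \<open>P^m x / ?r^m\<close> would tend to zero, the kernel of \<open>(lam - P)^k\<close> admitting
  only the eigenvalue \<open>lam\<close>. Yet its pairing with the left Perron vector of \<beta>
  never falls below the initial positive value.\<close>

lemma class_spectral_radius_le:
  fixes P :: "real^'n^'n"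
  assumes P: "\<forall>i j. 0 \<le> P $ i $ j" and I: "access_closed P I" and lam: "0 \<le> lam"
    and x: "\<And>i. i \<in> I \<Longrightarrow> 0 < x $ i" "x \<in> supported_on I"
      "((*v) (lam *\<^sub>R mat 1 - P) ^^ k) x = 0"
    and \<beta>: "\<beta> \<in> classes P" "\<beta> \<subseteq> I"
  shows "sub_spectral_radius P \<beta> \<le> lam"
proof (rule ccontr)
  let ?r = "sub_spectral_radius P \<beta>"
  let ?T = "(*v) (cmat (lam *\<^sub>R mat 1 - P))"
  assume "\<not> ?thesis"
  then have r: "lam < ?r" by simp
  obtain v where v: "\<And>j. j \<in> \<beta> \<Longrightarrow> 0 < v $ j"
    "\<And>j. j \<in> \<beta> \<Longrightarrow> (\<Sum>i\<in>\<beta>. v $ i * P $ i $ j) = ?r * v $ j"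
    using class_perron[OF P \<beta>(1)] by metis
  define W where "W = {z. (?T ^^ k) z = 0}"
  have decay: "(\<lambda>m. ((*v) (cmat P) ^^ m) (cvec x) $ i / of_real ?r ^ m) \<longlonglongrightarrow> 0" for i
  proof (rule power_iterates_decay[where W = W])
    show "a - b \<in> W" if "a \<in> W" "b \<in> W" for a b
      using that by (simp add: W_def funpow_mult_vec_diff)
    show "c *s a \<in> W" if "a \<in> W" for a c
      using that by (simp add: W_def funpow_mult_vec_scale)
    show "cmat P *v a \<in> W" if "a \<in> W" for a
    proof -
      have "?T (cmat P *v b) = cmat P *v (?T b)" for b
        by (simp add: cmat_shift_mult matrix_vector_mult_diff_distrib vector_scalar_commute)
      then show ?thesis
        using that funpow_commute[of ?T "(*v) (cmat P)" k 1 a] by (simp add: W_def)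
    qed
    show "cmod \<mu> < ?r" if z: "z \<in> W" "z \<noteq> 0" "cmat P *v z = \<mu> *s z" for \<mu> z
    proof -
      \<comment> \<open>On an eigenvector for \<mu> the map acts as the scalar
        \<open>lam - \<mu>\<close>, so membership in \<open>W\<close> forces \<mu> to equal
        \<open>lam\<close>.\<close>
      have "(?T ^^ m) z = (of_real lam - \<mu>) ^ m *s z" for m
      proof (induction m)
        case (Suc m)
        have "?T z = (of_real lam - \<mu>) *s z"
          using z(3) by (simp add: cmat_shift_mult vec.scale_left_diff_distrib)
        then show ?case using Suc
          by (simp add: vector_scalar_commute vector_smult_assoc left_diff_distrib vec.scale_left_diff_distrib mult.commute)
      qed simp
      then have "(of_real lam - \<mu>) ^ k *s z = 0" using z(1) by (simp add: W_def)
      then have "\<mu> = of_real lam" using z(2) by simp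
      then show ?thesis using lam r by simp
    qed
    have "cvec (((*v) (lam *\<^sub>R mat 1 - P) ^^ k) x) = 0" using x(3) by simp
    then show "cvec x \<in> W" by (simp add: W_def funpow_cmat_cvec)
  qed
  have "(\<lambda>m. ((*v) P ^^ m) x $ i / ?r ^ m) \<longlonglongrightarrow> 0" for i
  proof -
    have "(\<lambda>m. complex_of_real (((*v) P ^^ m) x $ i / ?r ^ m)) \<longlonglongrightarrow> complex_of_real 0"
      using decay[of i] unfolding funpow_cmat_cvec by (simp add: cvec_def)
    then show ?thesis by (simp only: tendsto_of_real_iff)
  qed
  then have "(\<lambda>m. \<Sum>i\<in>\<beta>. v $ i * (((*v) P ^^ m) x $ i / ?r ^ m)) \<longlonglongrightarrow> (\<Sum>i\<in>\<beta>. v $ i * 0)"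
    by (intro tendsto_intros)
  then have "(\<lambda>m. class_pairing \<beta> v (((*v) P ^^ m) x) / ?r ^ m) \<longlonglongrightarrow> 0"
    by (simp add: class_pairing_def sum_divide_distrib)
  moreover have "class_pairing \<beta> v x \<le> class_pairing \<beta> v (((*v) P ^^ m) x) / ?r ^ m" for m
  proof -
    have "(\<forall>i. 0 \<le> ((*v) P ^^ m) x $ i) \<and> ?r ^ m * class_pairing \<beta> v x \<le> class_pairing \<beta> v (((*v) P ^^ m) x)"
    proof (induction m)
      case 0
      have "0 \<le> x $ i" for i using x(1)[of i] x(2) by (cases "i \<in> I") (auto simp: supported_onD less_imp_le)
      then show ?case by simp
    next
      case (Suc m)
      let ?y = "((*v) P ^^ m) x"
      have "0 \<le> (P *v ?y) $ i" for i
        using nonneg_mult_mono[OF P, of 0 ?y i] Suc by simp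
      moreover have "?r * (?r ^ m * class_pairing \<beta> v x) \<le> ?r * class_pairing \<beta> v ?y"
        using Suc lam r by (intro mult_left_mono) auto
      then have "?r ^ Suc m * class_pairing \<beta> v x \<le> class_pairing \<beta> v (P *v ?y)"
        using class_pairing_mult_ge[OF P v, of ?y] Suc by simp
      ultimately show ?case by simp
    qed
    then show ?thesis using lam r by (simp add: field_simps)
  qed
  ultimately have "class_pairing \<beta> v x \<le> 0"
    by (intro LIMSEQ_le_const) auto
  moreover have "0 < class_pairing \<beta> v x"
    using \<beta> x(1) v(1) by (intro class_pairing_pos) auto
  ultimately show False by simp
qed

text \<open>Follow a path from \<beta> to an index of \<open>I\<close> outside \<beta> until the
  first arc that leaves \<beta>; its end has access to an index of \<open>I\<close>, hence lies in
  \<open>I\<close>.\<close>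

lemma not_final_exit:
  assumes I: "access_closed P I" and \<beta>: "\<beta> \<in> classes P" "\<beta> \<subseteq> I" "\<not> final_in P (initial_collection P I) \<beta>"
  obtains i j where "i \<in> \<beta>" "j \<in> I" "j \<notin> \<beta>" "P $ i $ j \<noteq> 0"
proof -
  obtain i l where il: "i \<in> \<beta>" "l \<in> I" "l \<notin> \<beta>" "has_access P i l"
    using \<beta> unfolding final_in_closed_iff[OF I] by blast
  have "i \<in> \<beta> \<longrightarrow> (\<exists>i\<in>\<beta>. \<exists>j\<in>I. j \<notin> \<beta> \<and> P $ i $ j \<noteq> 0)"
    using il(4) unfolding has_access_def
  proof (induction rule: converse_rtrancl_induct)
    case (step i k)
    have "k \<in> I" using step(2) il(2) access_closedD[OF I] by (simp add: has_access_def)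
    then show ?case using step by (auto simp: arcs_def)
  qed (use il in auto)
  then show ?thesis using that il(1) by blast
qed

text \<open>An arc leaving \<beta> inside \<open>I\<close> contributes a positive term beyond the
  block, making the pairing inequality strict.\<close>

lemma class_spectral_radius_less:
  fixes P :: "real^'n^'n"
  assumes P: "\<forall>i j. 0 \<le> P $ i $ j" and I: "access_closed P I"
    and x: "\<And>i. i \<in> I \<Longrightarrow> 0 < x $ i" "x \<in> supported_on I" "P *v x = lam *\<^sub>R x"
    and \<beta>: "\<beta> \<in> classes P" "\<beta> \<subseteq> I" "\<not> final_in P (initial_collection P I) \<beta>"
  shows "sub_spectral_radius P \<beta> < lam"
proof -
  let ?r = "sub_spectral_radius P \<beta>"
  obtain v where v: "\<And>j. j \<in> \<beta> \<Longrightarrow> 0 < v $ j"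
    "\<And>j. j \<in> \<beta> \<Longrightarrow> (\<Sum>i\<in>\<beta>. v $ i * P $ i $ j) = ?r * v $ j"
    using class_perron[OF P \<beta>(1)] by metis
  have nn: "0 \<le> x $ i" for i using x(1)[of i] x(2) by (cases "i \<in> I") (auto simp: supported_onD less_imp_le)
  have le: "(\<Sum>j\<in>\<beta>. P $ i $ j * x $ j) \<le> (P *v x) $ i" for i
    unfolding matrix_vector_mult_def using P nn by (simp add: sum_mono2)
  obtain i j where ij: "i \<in> \<beta>" "j \<in> I" "j \<notin> \<beta>" "P $ i $ j \<noteq> 0"
    using not_final_exit[OF I \<beta>] .
  have "0 < P $ i $ j * x $ j"
    using P ij x(1) by (simp add: less_le)
  then have "(\<Sum>j\<in>\<beta>. P $ i $ j * x $ j) < (\<Sum>j\<in>insert j \<beta>. P $ i $ j * x $ j)"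
    using ij by simp
  also have "\<dots> \<le> (P *v x) $ i"
    unfolding matrix_vector_mult_def using P nn by (simp add: sum_mono2)
  finally have less: "(\<Sum>j\<in>\<beta>. P $ i $ j * x $ j) < (P *v x) $ i" .
  have "?r * class_pairing \<beta> v x = (\<Sum>i\<in>\<beta>. v $ i * (\<Sum>j\<in>\<beta>. P $ i $ j * x $ j))"
    by (rule class_pairing_block[symmetric]) (rule v(2))
  also have "\<dots> < class_pairing \<beta> v (P *v x)"
    unfolding class_pairing_def
  proof (intro sum_strict_mono_ex1 ballI bexI)
    show "v $ i * (\<Sum>j\<in>\<beta>. P $ i $ j * x $ j) < v $ i * (P *v x) $ i"
      using less v(1)[OF ij(1)] by simp
    show "v $ i * (\<Sum>j\<in>\<beta>. P $ i $ j * x $ j) \<le> v $ i * (P *v x) $ i" if "i \<in> \<beta>" for i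
      using le[of i] v(1)[OF that] by simp
  qed (use ij in auto)
  also have "\<dots> = lam * class_pairing \<beta> v x"
    by (simp add: x(3) class_pairing_def sum_distrib_left mult.left_commute)
  finally show ?thesis
    using class_pairing_pos[OF \<beta>(1) v(1)] x(1) \<beta>(2) by (simp add: subset_iff)
qed

lemma class_access_subset:
  assumes I: "access_closed P I" and "\<alpha> \<in> classes P" "\<alpha> \<subseteq> I" "\<beta> \<in> classes P" "class_access P \<beta> \<alpha>"
  shows "\<beta> \<subseteq> I"
proof -
  obtain i j where "i \<in> \<beta>" "j \<in> \<alpha>" "has_access P i j"
    using assms(5) by (auto simp: class_access_def)
  then show ?thesis
    using class_subset_closed[OF I assms(4)] access_closedD[OF I] assms(3) by blast
qed

lemma accessing_class_not_final:
  assumes I: "access_closed P I" and "\<alpha> \<in> classes P" "\<alpha> \<subseteq> I" "\<beta> \<in> classes P" "class_access P \<beta> \<alpha>" "\<beta> \<noteq> \<alpha>"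
  shows "\<not> final_in P (initial_collection P I) \<beta>"
  using assms by (auto simp: final_in_def initial_collection_eq[OF I])

text \<open>The map fixes zero, so any exponent can be raised by one to a positive exponent.\<close>

lemma generalized_eigenvector_iff:
  "generalized_eigenvector P lam x \<longleftrightarrow> x \<noteq> 0 \<and> (\<exists>k. ((*v) (lam *\<^sub>R mat 1 - P) ^^ k) x = 0)"
proof -
  have "\<exists>k>0. ((*v) (lam *\<^sub>R mat 1 - P) ^^ k) x = 0" if "((*v) (lam *\<^sub>R mat 1 - P) ^^ k) x = 0" for k
    using that by (intro exI[of _ "Suc k"]) simp
  then show ?thesis unfolding generalized_eigenvector_def by blast
qed

lemma rel_interior_support_face_iff:
  "x \<in> rel_interior (support_face I) \<longleftrightarrow> (\<forall>i\<in>I. 0 < x $ i) \<and> x \<in> supported_on I"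
  by (auto simp: rel_interior_support_face supported_on_def)

lemma positive_supported_nonzero_iff:
  fixes x :: "real^'n"
  assumes "\<forall>i\<in>I. 0 < x $ i" "x \<in> supported_on I"
  shows "x \<noteq> 0 \<longleftrightarrow> I \<noteq> {}"
  using assms by (auto simp: vec_eq_iff supported_on_def)

lemma exists_final:
  assumes "access_closed P I" "I \<noteq> {}"
  obtains \<alpha> where "final_in P (initial_collection P I) \<alpha>"
  using assms exists_final_class by (metis ex_in_conv)

text \<open>Transfers hypotheses about final classes into spectral bounds for the other classes of
  \<open>I\<close>.\<close>

lemma final_class_dominates:
  assumes I: "access_closed P I" and \<beta>: "\<beta> \<in> classes P" "\<beta> \<subseteq> I" "\<not> final_in P (initial_collection P I) \<beta>"
  obtains \<alpha> where "final_in P (initial_collection P I) \<alpha>" "class_access P \<beta> \<alpha>" "\<beta> \<noteq> \<alpha>"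
proof -
  obtain i where i: "i \<in> \<beta>" using class_nonempty[OF \<beta>(1)] by blast
  then obtain \<alpha> j where "final_in P (initial_collection P I) \<alpha>" "j \<in> \<alpha>" "has_access P i j"
    using exists_final_class[OF I] \<beta>(2) by blast
  then show ?thesis using that i \<beta>(3) unfolding class_access_def by blast
qed

section \<open>Generalized eigenvectors and eigenvectors in the relative interior\<close>

lemma generalized_eigenvector_in_rel_interior_iff:
  fixes P :: "real^'n^'n"
  assumes P: "\<forall>i j. 0 \<le> P $ i $ j" and I: "access_closed P I"
  shows "(\<exists>x \<in> rel_interior (support_face I). generalized_eigenvector P lam x) \<longleftrightarrow>
    I \<noteq> {} \<and> (\<forall>\<alpha>. final_in P (initial_collection P I) \<alpha> \<longrightarrow>
      semi_distinguished_class P \<alpha> \<and> associated_with P \<alpha> lam)"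
proof
  assume "\<exists>x \<in> rel_interior (support_face I). generalized_eigenvector P lam x"
  then obtain x where mem: "x \<in> rel_interior (support_face I)" and gen: "generalized_eigenvector P lam x"
    by blast
  obtain k where "((*v) (lam *\<^sub>R mat 1 - P) ^^ k) x = 0" "x \<noteq> 0"
    using gen unfolding generalized_eigenvector_iff by blast
  with mem have x: "\<And>i. i \<in> I \<Longrightarrow> 0 < x $ i" "x \<in> supported_on I"
      "((*v) (lam *\<^sub>R mat 1 - P) ^^ k) x = 0" and ne: "I \<noteq> {}"
    unfolding rel_interior_support_face_iff using positive_supported_nonzero_iff by blast+
  have fin: "sub_spectral_radius P \<alpha> = lam" if "final_in P (initial_collection P I) \<alpha>" for \<alpha>
    using final_class_spectral_radius[OF P I x that] .
  \<comment> \<open>Nothing is assumed about the sign of \<open>lam\<close>; it is read off from the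
    spectral radius of some final class, which exists because \<open>I\<close> is nonempty.\<close>
  have lam: "0 \<le> lam"
  proof -
    obtain \<alpha> where \<alpha>: "final_in P (initial_collection P I) \<alpha>" using exists_final[OF I ne] .
    then have "\<alpha> \<in> classes P" unfolding final_in_closed_iff[OF I] by blast
    then have "0 \<le> sub_spectral_radius P \<alpha>" using class_perron[OF P] by blast
    then show ?thesis using fin[OF \<alpha>] by simp
  qed
  have "semi_distinguished_class P \<alpha>" if \<alpha>: "final_in P (initial_collection P I) \<alpha>" for \<alpha>
  proof -
    have cl: "\<alpha> \<in> classes P" "\<alpha> \<subseteq> I" using \<alpha> unfolding final_in_closed_iff[OF I] by auto
    then show ?thesis
      unfolding semi_distinguished_class_def fin[OF \<alpha>]
      using class_spectral_radius_le[OF P I lam x] class_access_subset[OF I cl] by blast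
  qed
  then show "I \<noteq> {} \<and> (\<forall>\<alpha>. final_in P (initial_collection P I) \<alpha> \<longrightarrow>
      semi_distinguished_class P \<alpha> \<and> associated_with P \<alpha> lam)"
    using ne fin by (simp add: associated_with_def)
next
  assume R: "I \<noteq> {} \<and> (\<forall>\<alpha>. final_in P (initial_collection P I) \<alpha> \<longrightarrow>
      semi_distinguished_class P \<alpha> \<and> associated_with P \<alpha> lam)"
  then have fin: "\<forall>\<alpha>. final_in P (initial_collection P I) \<alpha> \<longrightarrow> sub_spectral_radius P \<alpha> = lam"
    by (simp add: associated_with_def)
  obtain \<alpha> where \<alpha>: "final_in P (initial_collection P I) \<alpha>" using exists_final[OF I] R by blast
  then have "\<alpha> \<in> classes P" unfolding final_in_closed_iff[OF I] by blast
  then have "0 \<le> sub_spectral_radius P \<alpha>" using class_perron[OF P] by blast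
  then have lam: "0 \<le> lam" using fin \<alpha> by simp
  have bound: "sub_spectral_radius P \<beta> \<le> lam" if \<beta>: "\<beta> \<in> classes P" "\<beta> \<subseteq> I" for \<beta>
  proof (cases "final_in P (initial_collection P I) \<beta>")
    case False
    obtain \<alpha> where "final_in P (initial_collection P I) \<alpha>" "class_access P \<beta> \<alpha>" "\<beta> \<noteq> \<alpha>"
      using final_class_dominates[OF I \<beta> False] .
    then show ?thesis using R \<beta>(1) fin by (auto simp: semi_distinguished_class_def)
  qed (use fin in auto)
  obtain y k where y: "\<forall>i\<in>I. 0 < y $ i" "y \<in> supported_on I" "((*v) (lam *\<^sub>R mat 1 - P) ^^ k) y = 0"
    using positive_generalized_eigenvector_exists[OF P I lam bound fin] by blast
  then have "y \<noteq> 0" using R positive_supported_nonzero_iff by blast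
  then show "\<exists>x \<in> rel_interior (support_face I). generalized_eigenvector P lam x"
    using y by (auto simp: rel_interior_support_face_iff generalized_eigenvector_iff)
qed

lemma eigenvector_in_rel_interior_iff:
  fixes P :: "real^'n^'n"
  assumes P: "\<forall>i j. 0 \<le> P $ i $ j" and I: "access_closed P I"
  shows "(\<exists>x \<in> rel_interior (support_face I). eigenvector P lam x) \<longleftrightarrow>
    I \<noteq> {} \<and> (\<forall>\<alpha>. final_in P (initial_collection P I) \<alpha> \<longrightarrow>
      distinguished_class P \<alpha> \<and> associated_with P \<alpha> lam)"
proof
  assume "\<exists>x \<in> rel_interior (support_face I). eigenvector P lam x"
  then obtain x where mem: "x \<in> rel_interior (support_face I)" and eig: "eigenvector P lam x"
    by blast
  then have x: "\<And>i. i \<in> I \<Longrightarrow> 0 < x $ i" "x \<in> supported_on I" "P *v x = lam *\<^sub>R x" and ne: "I \<noteq> {}"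
    unfolding rel_interior_support_face_iff eigenvector_def using positive_supported_nonzero_iff by blast+
  \<comment> \<open>An eigenvector is the kernel case with exponent 1, so the final classes are
    handled as before.\<close>
  have x1: "((*v) (lam *\<^sub>R mat 1 - P) ^^ 1) x = 0"
    using x(3) by (simp add: shift_mult)
  have fin: "sub_spectral_radius P \<alpha> = lam" if "final_in P (initial_collection P I) \<alpha>" for \<alpha>
    using final_class_spectral_radius[OF P I x(1,2) x1 that] .
  have "distinguished_class P \<alpha>" if \<alpha>: "final_in P (initial_collection P I) \<alpha>" for \<alpha>
  proof -
    have cl: "\<alpha> \<in> classes P" "\<alpha> \<subseteq> I" using \<alpha> unfolding final_in_closed_iff[OF I] by auto
    then show ?thesis
      unfolding distinguished_class_def fin[OF \<alpha>]
      using class_spectral_radius_less[OF P I x] class_access_subset[OF I cl]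
        accessing_class_not_final[OF I cl] by blast
  qed
  then show "I \<noteq> {} \<and> (\<forall>\<alpha>. final_in P (initial_collection P I) \<alpha> \<longrightarrow>
      distinguished_class P \<alpha> \<and> associated_with P \<alpha> lam)"
    using ne fin by (simp add: associated_with_def)
next
  assume R: "I \<noteq> {} \<and> (\<forall>\<alpha>. final_in P (initial_collection P I) \<alpha> \<longrightarrow>
      distinguished_class P \<alpha> \<and> associated_with P \<alpha> lam)"
  then have fin: "\<forall>\<alpha>. final_in P (initial_collection P I) \<alpha> \<longrightarrow> sub_spectral_radius P \<alpha> = lam"
    by (simp add: associated_with_def)
  obtain \<alpha> where \<alpha>: "final_in P (initial_collection P I) \<alpha>" using exists_final[OF I] R by blast
  then have "\<alpha> \<in> classes P" unfolding final_in_closed_iff[OF I] by blast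
  then have "0 \<le> sub_spectral_radius P \<alpha>" using class_perron[OF P] by blast
  then have lam: "0 \<le> lam" using fin \<alpha> by simp
  have bound: "sub_spectral_radius P \<beta> < lam"
    if \<beta>: "\<beta> \<in> classes P" "\<beta> \<subseteq> I" "\<not> final_in P (initial_collection P I) \<beta>" for \<beta>
  proof -
    obtain \<alpha> where "final_in P (initial_collection P I) \<alpha>" "class_access P \<beta> \<alpha>" "\<beta> \<noteq> \<alpha>"
      using final_class_dominates[OF I \<beta>] .
    then show ?thesis using R \<beta>(1) fin by (auto simp: distinguished_class_def)
  qed
  obtain y where y: "\<forall>i\<in>I. 0 < y $ i" "y \<in> supported_on I" "P *v y = lam *\<^sub>R y"
    using positive_eigenvector_exists[OF P I lam bound fin] by blast
  then have "y \<noteq> 0" using R positive_supported_nonzero_iff by blast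
  then show "\<exists>x \<in> rel_interior (support_face I). eigenvector P lam x"
    using y by (auto simp: rel_interior_support_face_iff eigenvector_def)
qed

theorem theorem3p6:
  fixes P :: "real^'n^'n" and I :: "'n set" and lam :: real
  assumes "\<forall>i j. 0 \<le> P $ i $ j"
    and "initial_subset P I"
  shows
    "(minimal_nonzero_invariant_face P (support_face I) \<longleftrightarrow> initial_class P I)
   \<and> (join_irreducible_face P (support_face I) \<and> support_face I \<noteq> {0} \<longleftrightarrow>
        initial_subset P I \<and> (\<exists>\<alpha>. determined_by P I \<alpha>))
   \<and> (invariant_face P (support_face I) \<and>
        (\<exists>x \<in> rel_interior (support_face I). generalized_eigenvector P lam x) \<longleftrightarrow>
        I \<noteq> {} \<and> initial_subset P I \<and>
        (\<forall>\<alpha>. final_in P (initial_collection P I) \<alpha> \<longrightarrow>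
           semi_distinguished_class P \<alpha> \<and> associated_with P \<alpha> lam))
   \<and> (invariant_face P (support_face I) \<and>
        (\<exists>x \<in> rel_interior (support_face I). eigenvector P lam x) \<longleftrightarrow>
        I \<noteq> {} \<and> initial_subset P I \<and>
        (\<forall>\<alpha>. final_in P (initial_collection P I) \<alpha> \<longrightarrow>
           distinguished_class P \<alpha> \<and> associated_with P \<alpha> lam))
   \<and> (join_irreducible_face P (support_face I) \<and>
        (\<exists>x \<in> rel_interior (support_face I). generalized_eigenvector P lam x) \<longleftrightarrow>
        initial_subset P I \<and>
        (\<exists>\<alpha>. semi_distinguished_class P \<alpha> \<and> associated_with P \<alpha> lam \<and> determined_by P I \<alpha>))
   \<and> (join_irreducible_face P (support_face I) \<and>
        (\<exists>x \<in> rel_interior (support_face I). eigenvector P lam x) \<longleftrightarrow>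
        initial_subset P I \<and>
        (\<exists>\<alpha>. distinguished_class P \<alpha> \<and> associated_with P \<alpha> lam \<and> determined_by P I \<alpha>))"
proof -
  note P = assms(1)
  have I: "access_closed P I" using assms(2) by (simp add: initial_subset_iff)
  have inv: "invariant_face P (support_face I)"
    using I by (simp add: invariant_face_support_face_iff[OF P])
  have ne: "I \<noteq> {}" if "determined_by P I \<alpha>" for \<alpha>
  proof -
    have cl: "\<alpha> \<in> classes P" using that by (simp add: determined_by_def)
    then obtain a where "a \<in> \<alpha>" using class_nonempty by blast
    then show ?thesis using determined_by_iff[OF cl] that has_access_refl by blast
  qed
  \<comment> \<open>The conjunct \<open>I \<noteq> {}\<close> sets aside the zero face, which is
    vacuously join-irreducible because no face lies properly inside it.\<close>
  have irr: "join_irreducible_face P (support_face I) \<and> I \<noteq> {} \<longleftrightarrow> (\<exists>\<alpha>. determined_by P I \<alpha>)"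
    using join_irreducible_face_iff[OF P I] ne by blast
  have fin: "final_in P (initial_collection P I) \<beta> \<longleftrightarrow> \<beta> = \<alpha>" if "determined_by P I \<alpha>" for \<alpha> \<beta>
    using final_in_determined[OF _ that] that by (simp add: determined_by_def)
  \<comment> \<open>When \<open>I\<close> is determined by a class, that class is the only final
    one, so the condition on all final classes becomes a condition on it. The two choices of
    \<open>Q\<close> below give both versions of (iv).\<close>
  have single: "join_irreducible_face P (support_face I) \<and> I \<noteq> {} \<and>
      (\<forall>\<alpha>. final_in P (initial_collection P I) \<alpha> \<longrightarrow> Q \<alpha>) \<longleftrightarrow> (\<exists>\<alpha>. Q \<alpha> \<and> determined_by P I \<alpha>)" for Q
    using irr fin by metis
  show ?thesis
    unfolding generalized_eigenvector_in_rel_interior_iff[OF P I] eigenvector_in_rel_interior_iff[OF P I]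
      support_face_eq_zero_iff
    using minimal_nonzero_invariant_face_iff[OF P I] assms(2) inv irr
      single[of "\<lambda>\<alpha>. semi_distinguished_class P \<alpha> \<and> associated_with P \<alpha> lam"]
      single[of "\<lambda>\<alpha>. distinguished_class P \<alpha> \<and> associated_with P \<alpha> lam"]
    by (simp only: conj_assoc simp_thms)
qed

end
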